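(* Let $G$ be any connected graph and let $U\subseteq V(G)$ be any vertex set. Then exactly one of the following two assertions holds: (i) $G$ contains a comb attached to $U$; (ii) $G$ has a rayless tree-decomposition into parts each containing at most finitely many vertices from $U$ and whose parts at non-leaves of the decomposition tree are all finite. Moreover, the rayless tree-decomposition in (ii) displays $\partial_\Omega U$ and may be chosen with connected separators.
   Context: Graphs may be infinite. A ray is a one-way infinite path. A comb is the union of a ray $R$ (its spine) with infinitely many disjoint finite paths, possibly trivial, that have precisely their first vertex on $R$; the last vertices of these paths are its teeth. A comb attached to $U$ is a comb all of whose teeth lie in $U$. A tree-decomposition $(T,\mathcal V)$ of $G$, with $\mathcal V=(V_t)_{t\in T}$, is a (possibly infinite) tree $T$ with parts $V_t\subseteq V(G)$ such that $\bigcup_t V_t=V(G)$, every edge of $G$ has both ends in some part, and $V_{t_1}\cap V_{t_3}\subseteq V_{t_2}$ whenever $t_2$ lies on the path $t_1Tt_3$. It is rayless if $T$ contains no ray. Its separators (adhesion sets) are the sets $V_x\cap V_y$ for edges $xy$ of $T$; a separator $X$ is connected if $G[X]$ is connected. An end of $G$ is an equivalence class of rays, two rays being equivalent if for every finite $X\subseteq V(G)$ they have tails in the same component of $G-X$; $C(X,\omega)$ is the component of $G-X$ containing a tail of every ray of the end $\omega$. $\Omega(G)$ is the set of ends of $G$. $\partial_\Omega U$ is the set of ends $\omega$ of $G$ in the closure of $U$, i.e. such that $C(X,\omega)$ meets $U$ for every finite $X\subseteq V(G)$. Display: let $(T,\mathcal V)$ be a tree-decomposition with finite separators. For an edge $xy$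 of $T$ let $T_x,T_y$ be the components of $T-xy$ containing $x$ and $y$, and let $A=\bigcup_{t\in T_x}V_t$, $B=\bigcup_{t\in T_y}V_t$. An end $\omega$ of $G$ orients $xy$ towards $y$ if its rays have tails in $G[B]$ that avoid $A$, and towards $x$ in the symmetric case. Then $\omega$ either lives at a unique node $t$ (all edges at $t$ are oriented towards $t$) or corresponds to a unique end $\eta$ of $T$ (for a ray $t_1t_2\dots\in\eta$ every edge $t_nt_{n+1}$ is oriented towards $t_{n+1}$). This defines $\tau\colon\Omega(G)\to\Omega(T)\sqcup V(T)$. $(T,\mathcal V)$ displays $\Psi\subseteq\Omega(G)$ if $\tau$ restricts to a bijection $\Psi\to\Omega(T)$ and maps every end of $G$ not in $\Psi$ to a node of $T$. *)

theory Defs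
  imports Main
begin

section \<open>Graphs, possibly infinite\<close>

record 'a graph =
  verts :: "'a set"
  edges :: "'a set set"

definition simple_graph :: "'a graph \<Rightarrow> bool" where
  "simple_graph G \<longleftrightarrow> (\<forall>e\<in>edges G. e \<subseteq> verts G \<and> card e = 2)"

definition adj :: "'a graph \<Rightarrow> 'a \<Rightarrow> 'a \<Rightarrow> bool" where
  "adj G x y \<longleftrightarrow> {x, y} \<in> edges G"

definition induced :: "'a graph \<Rightarrow> 'a set \<Rightarrow> 'a graph" where
  "induced G X = \<lparr>verts = verts G \<inter> X, edges = {e \<in> edges G. e \<subseteq> X}\<rparr>"

definition delete_verts :: "'a graph \<Rightarrow> 'a set \<Rightarrow> 'a graph" where
  "delete_verts G X = induced G (verts G - X)"

definition delete_edge :: "'a graph \<Rightarrow> 'a set \<Rightarrow> 'a graph" where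
  "delete_edge G e = \<lparr>verts = verts G, edges = edges G - {e}\<rparr>"

text \<open>Finite paths are given by their nonempty vertex sequences; a single vertex is a
  (trivial) path.\<close>

definition is_path :: "'a graph \<Rightarrow> 'a list \<Rightarrow> bool" where
  "is_path G p \<longleftrightarrow> p \<noteq> [] \<and> distinct p \<and> set p \<subseteq> verts G \<and> successively (adj G) p"

definition path_between :: "'a graph \<Rightarrow> 'a \<Rightarrow> 'a list \<Rightarrow> 'a \<Rightarrow> bool" where
  "path_between G x p y \<longleftrightarrow> is_path G p \<and> hd p = x \<and> last p = y"

definition linked :: "'a graph \<Rightarrow> 'a \<Rightarrow> 'a \<Rightarrow> bool" where
  "linked G x y \<longleftrightarrow> (\<exists>p. path_between G x p y)"

text \<open>As usual, connected graphs are nonempty.\<close>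

definition connected_graph :: "'a graph \<Rightarrow> bool" where
  "connected_graph G \<longleftrightarrow> verts G \<noteq> {} \<and> (\<forall>x\<in>verts G. \<forall>y\<in>verts G. linked G x y)"

text \<open>Components are represented by their vertex sets.\<close>

definition component_of :: "'a graph \<Rightarrow> 'a \<Rightarrow> 'a set" where
  "component_of G x = {y. linked G x y}"

definition components :: "'a graph \<Rightarrow> 'a set set" where
  "components G = component_of G ` verts G"

definition is_cycle :: "'a graph \<Rightarrow> 'a list \<Rightarrow> bool" where
  "is_cycle G p \<longleftrightarrow> is_path G p \<and> length p \<ge> 3 \<and> adj G (last p) (hd p)"

definition is_tree :: "'a graph \<Rightarrow> bool" where
  "is_tree T \<longleftrightarrow> simple_graph T \<and> connected_graph T \<and> (\<nexists>p. is_cycle T p)"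

definition leaf :: "'a graph \<Rightarrow> 'a \<Rightarrow> bool" where
  "leaf T t \<longleftrightarrow> t \<in> verts T \<and> card {s. adj T t s} = 1"


section \<open>Rays, combs and ends\<close>

text \<open>A ray has a unique first vertex, so rays correspond exactly to their vertex
  sequences.\<close>

definition is_ray :: "'a graph \<Rightarrow> (nat \<Rightarrow> 'a) \<Rightarrow> bool" where
  "is_ray G r \<longleftrightarrow> inj r \<and> range r \<subseteq> verts G \<and> (\<forall>n. adj G (r n) (r (Suc n)))"

definition rayless :: "'a graph \<Rightarrow> bool" where
  "rayless G \<longleftrightarrow> (\<nexists>r. is_ray G r)"

text \<open>A comb with spine \<open>r\<close>; the set \<open>P\<close> consists of its infinitely many disjoint paths.\<close>

definition is_comb :: "'a graph \<Rightarrow> (nat \<Rightarrow> 'a) \<Rightarrow> 'a list set \<Rightarrow> bool" where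
  "is_comb G r P \<longleftrightarrow>
     is_ray G r \<and> infinite P \<and>
     (\<forall>p\<in>P. is_path G p \<and> set p \<inter> range r = {hd p}) \<and>
     pairwise (\<lambda>p q. set p \<inter> set q = {}) P"

definition teeth :: "'a list set \<Rightarrow> 'a set" where
  "teeth P = last ` P"

definition has_comb_attached_to :: "'a graph \<Rightarrow> 'a set \<Rightarrow> bool" where
  "has_comb_attached_to G U \<longleftrightarrow> (\<exists>r P. is_comb G r P \<and> teeth P \<subseteq> U)"

definition has_tail_in :: "(nat \<Rightarrow> 'a) \<Rightarrow> 'a set \<Rightarrow> bool" where
  "has_tail_in r C \<longleftrightarrow> (\<exists>n. r ` {n..} \<subseteq> C)"

definition ray_equiv :: "'a graph \<Rightarrow> ((nat \<Rightarrow> 'a) \<times> (nat \<Rightarrow> 'a)) set" where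
  "ray_equiv G = {(r, s). is_ray G r \<and> is_ray G s \<and>
     (\<forall>X. finite X \<and> X \<subseteq> verts G \<longrightarrow>
        (\<exists>C\<in>components (delete_verts G X). has_tail_in r C \<and> has_tail_in s C))}"

definition ends :: "'a graph \<Rightarrow> (nat \<Rightarrow> 'a) set set" where
  "ends G = {r. is_ray G r} // ray_equiv G"

definition end_component :: "'a graph \<Rightarrow> 'a set \<Rightarrow> (nat \<Rightarrow> 'a) set \<Rightarrow> 'a set" where
  "end_component G X \<omega> =
     (THE C. C \<in> components (delete_verts G X) \<and> (\<forall>r\<in>\<omega>. has_tail_in r C))"

text \<open>\<open>boundary_ends G U\<close> is the set \<open>\<partial>\<^sub>\<Omega> U\<close> of ends of \<open>G\<close> in the closure of \<open>U\<close>.\<close>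

definition boundary_ends :: "'a graph \<Rightarrow> 'a set \<Rightarrow> (nat \<Rightarrow> 'a) set set" where
  "boundary_ends G U = {\<omega> \<in> ends G.
     \<forall>X. finite X \<and> X \<subseteq> verts G \<longrightarrow> end_component G X \<omega> \<inter> U \<noteq> {}}"


section \<open>Tree-decompositions\<close>

text \<open>The parts are given by a function \<open>\<V>\<close>, of which only the values on \<open>verts T\<close> matter.
  In a tree the path between two nodes is unique, so the quantification over all paths \<open>p\<close>
  below refers to exactly one path.\<close>

definition tree_decomposition :: "'a graph \<Rightarrow> 't graph \<Rightarrow> ('t \<Rightarrow> 'a set) \<Rightarrow> bool" where
  "tree_decomposition G T \<V> \<longleftrightarrow>
     is_tree T \<and>
     (\<Union>t\<in>verts T. \<V> t) = verts G \<and>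
     (\<forall>e\<in>edges G. \<exists>t\<in>verts T. e \<subseteq> \<V> t) \<and>
     (\<forall>t\<^sub>1 t\<^sub>3 p. path_between T t\<^sub>1 p t\<^sub>3 \<longrightarrow> (\<forall>t\<^sub>2\<in>set p. \<V> t\<^sub>1 \<inter> \<V> t\<^sub>3 \<subseteq> \<V> t\<^sub>2))"

definition separators :: "'t graph \<Rightarrow> ('t \<Rightarrow> 'a set) \<Rightarrow> 'a set set" where
  "separators T \<V> = {\<V> x \<inter> \<V> y | x y. adj T x y}"

definition finite_separators :: "'t graph \<Rightarrow> ('t \<Rightarrow> 'a set) \<Rightarrow> bool" where
  "finite_separators T \<V> \<longleftrightarrow> (\<forall>X\<in>separators T \<V>. finite X)"

definition connected_separators :: "'a graph \<Rightarrow> 't graph \<Rightarrow> ('t \<Rightarrow> 'a set) \<Rightarrow> bool" where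
  "connected_separators G T \<V> \<longleftrightarrow> (\<forall>X\<in>separators T \<V>. connected_graph (induced G X))"

text \<open>For an edge \<open>xy\<close> of \<open>T\<close>, the union of the parts at the nodes in the component of
  \<open>T - xy\<close> that contains \<open>x\<close>.\<close>

definition side :: "'t graph \<Rightarrow> ('t \<Rightarrow> 'a set) \<Rightarrow> 't \<Rightarrow> 't \<Rightarrow> 'a set" where
  "side T \<V> x y = (\<Union>t\<in>component_of (delete_edge T {x, y}) x. \<V> t)"

definition orients_towards ::
    "'t graph \<Rightarrow> ('t \<Rightarrow> 'a set) \<Rightarrow> (nat \<Rightarrow> 'a) set \<Rightarrow> 't \<Rightarrow> 't \<Rightarrow> bool" where
  "orients_towards T \<V> \<omega> x y \<longleftrightarrow> (\<forall>r\<in>\<omega>. has_tail_in r (side T \<V> y x - side T \<V> x y))"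

definition lives_at ::
    "'t graph \<Rightarrow> ('t \<Rightarrow> 'a set) \<Rightarrow> (nat \<Rightarrow> 'a) set \<Rightarrow> 't \<Rightarrow> bool" where
  "lives_at T \<V> \<omega> t \<longleftrightarrow> t \<in> verts T \<and> (\<forall>s. adj T s t \<longrightarrow> orients_towards T \<V> \<omega> s t)"

definition corresponds_to ::
    "'t graph \<Rightarrow> ('t \<Rightarrow> 'a set) \<Rightarrow> (nat \<Rightarrow> 'a) set \<Rightarrow> (nat \<Rightarrow> 't) set \<Rightarrow> bool" where
  "corresponds_to T \<V> \<omega> \<eta> \<longleftrightarrow> \<eta> \<in> ends T \<and>
     (\<forall>r\<in>\<eta>. \<forall>n. orients_towards T \<V> \<omega> (r n) (r (Suc n)))"

text \<open>For a tree-decomposition with finite separators, exactly one end or node of \<open>T\<close>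
  satisfies the description below for each end \<open>\<omega>\<close> of \<open>G\<close>; otherwise \<open>end_map\<close>, and
  hence \<open>displays\<close>, is not meaningful.\<close>

definition end_map ::
    "'t graph \<Rightarrow> ('t \<Rightarrow> 'a set) \<Rightarrow> (nat \<Rightarrow> 'a) set \<Rightarrow> (nat \<Rightarrow> 't) set + 't" where
  "end_map T \<V> \<omega> = (THE z. case z of
     Inl \<eta> \<Rightarrow> corresponds_to T \<V> \<omega> \<eta>
   | Inr t \<Rightarrow> lives_at T \<V> \<omega> t)"

definition displays ::
    "'a graph \<Rightarrow> 't graph \<Rightarrow> ('t \<Rightarrow> 'a set) \<Rightarrow> (nat \<Rightarrow> 'a) set set \<Rightarrow> bool" where
  "displays G T \<V> \<Psi> \<longleftrightarrow>
     bij_betw (end_map T \<V>) \<Psi> (Inl ` ends T) \<and>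
     (\<forall>\<omega>\<in>ends G - \<Psi>. end_map T \<V> \<omega> \<in> Inr ` verts T)"

definition rayless_decomposition_for ::
    "'a graph \<Rightarrow> 'a set \<Rightarrow> 't graph \<Rightarrow> ('t \<Rightarrow> 'a set) \<Rightarrow> bool" where
  "rayless_decomposition_for G U T \<V> \<longleftrightarrow>
     tree_decomposition G T \<V> \<and> rayless T \<and>
     (\<forall>t\<in>verts T. finite (\<V> t \<inter> U)) \<and>
     (\<forall>t\<in>verts T. \<not> leaf T t \<longrightarrow> finite (\<V> t))"

end

theory Submission
  imports Defs
begin

text \<open>
  Every end orients the edges of the decomposition tree, and in a rayless tree the orientation has
  a unique sink.  This node cannot have a finite part, so it is a leaf, and a finite separator
  together with the finitely many vertices of \<open>U\<close> in the leaf part cuts the end off from \<open>U\<close>.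
  Hence no end lies in the closure of \<open>U\<close>, and by the same argument applied to the spine there is
  no comb attached to \<open>U\<close>.

  Conversely, delete a path ending in \<open>U\<close>, then in every component that still meets \<open>U\<close> a
  path from a neighbour of the previous path to \<open>U\<close>, and so on.  The components arising in this
  way form a tree, and the part of a component consists of the paths deleted before it, together
  with its own path or, if it avoids \<open>U\<close>, with the whole component.  The union of the paths
  deleted before a component is finite and connected, and it is the separator to its parent.
  An infinite branch would string the paths together to a comb.
\<close>


section \<open>Linked vertices\<close>

text \<open>An infinite branch yields a comb only if consecutive paths are joined by an edge, so
  each new path must start next to the path deleted just before it, not merely next to some earlier
  one. Such a start exists because the previous component is connected: whatever component remains
  after deleting a path has a neighbour on that path.

  The deletion process is run for every vertex \<open>v\<close> separately, following the component
  that contains \<open>v\<close>. The choices depend only on the previous path and the current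
  component, so vertices that are still together share their whole history, and the tree is read off
  afterwards from the finite time at which each vertex stops. The nodes are themselves vertices of
  \<open>G\<close>, so the tree lives on the same type.

  If \<open>U\<close> were empty, the tree would be a single node, which is not a leaf, with all of
  \<open>G\<close> as its part. Adding one vertex to \<open>U\<close> creates no comb and removes
  this case.\<close>

lemma linked_iff_rtranclp:
  "linked G x y \<longleftrightarrow> x \<in> verts G \<and> (\<lambda>a b. b \<in> verts G \<and> adj G a b)\<^sup>*\<^sup>* x y"
    (is "_ \<longleftrightarrow> _ \<and> ?R\<^sup>*\<^sup>* x y")
proof
  assume "linked G x y"
  then obtain p where "is_path G p" "hd p = x" "last p = y"
    by (auto simp: linked_def path_between_def)
  then show "x \<in> verts G \<and> ?R\<^sup>*\<^sup>* x y"
  proof (induction p arbitrary: x)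
    case (Cons a p)
    show ?case
    proof (cases "p = []")
      case False
      then have "is_path G p" "adj G a (hd p)" "a = x" "last p = y" "hd p \<in> verts G"
        using Cons.prems by (auto simp: is_path_def successively_Cons)
      then show ?thesis
        using Cons.IH[of "hd p"] Cons.prems
        by (auto simp: is_path_def intro: converse_rtranclp_into_rtranclp)
    qed (use Cons.prems in \<open>auto simp: is_path_def\<close>)
  qed (simp add: is_path_def)
next
  assume *: "x \<in> verts G \<and> ?R\<^sup>*\<^sup>* x y"
  then have "?R\<^sup>*\<^sup>* x y" by simp
  then show "linked G x y"
  proof (induction rule: rtranclp_induct)
    case base
    then have "path_between G x [x] x"
      using * by (simp add: path_between_def is_path_def)
    then show ?case by (auto simp: linked_def)
  next
    case (step y z)
    then obtain p where p: "is_path G p" "hd p = x" "last p = y"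
      by (auto simp: linked_def path_between_def)
    \<comment> \<open>Appending \<open>z\<close> may repeat a vertex; then the path is cut at the
      earlier occurrence. Afterwards transitivity comes from the closure, without concatenating
      paths.\<close>
    show ?case
    proof (cases "z \<in> set p")
      case True
      then obtain p1 p2 where eq: "p = p1 @ z # p2" by (auto dest: split_list)
      then have "path_between G x (p1 @ [z]) z"
        using p by (auto simp: path_between_def is_path_def successively_append_iff hd_append)
      then show ?thesis by (auto simp: linked_def)
    next
      case False
      then have "path_between G x (p @ [z]) z"
        using p step by (auto simp: path_between_def is_path_def successively_append_iff)
      then show ?thesis by (auto simp: linked_def)
    qed
  qed
qed

lemma linked_refl: "x \<in> verts G \<Longrightarrow> linked G x x"
  by (simp add: linked_iff_rtranclp)

lemma linked_step: "linked G x y \<Longrightarrow> z \<in> verts G \<Longrightarrow> adj G y z \<Longrightarrow> linked G x z"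
  by (auto simp: linked_iff_rtranclp intro: rtranclp.rtrancl_into_rtrancl)

lemma linked_trans: "linked G x y \<Longrightarrow> linked G y z \<Longrightarrow> linked G x z"
  by (auto simp: linked_iff_rtranclp)

lemma linked_closed:
  assumes "linked G x y" "x \<in> A"
    and "\<And>a b. a \<in> A \<Longrightarrow> b \<in> verts G \<Longrightarrow> adj G a b \<Longrightarrow> b \<in> A"
  shows "y \<in> A"
proof -
  have "(\<lambda>a b. b \<in> verts G \<and> adj G a b)\<^sup>*\<^sup>* x y"
    using assms(1) by (simp add: linked_iff_rtranclp)
  then show ?thesis
    by (induction rule: rtranclp_induct) (use assms(2,3) in blast)+
qed

lemma linked_verts: "linked G x y \<Longrightarrow> x \<in> verts G \<and> y \<in> verts G"
  by (auto simp: linked_def path_between_def is_path_def)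

lemma adj_commute: "adj G x y \<longleftrightarrow> adj G y x"
  by (simp add: adj_def insert_commute)

lemma linked_sym: assumes "linked G x y" shows "linked G y x"
proof -
  have "y \<in> {z. z \<in> verts G \<and> linked G z x}"
    using assms
  proof (rule linked_closed)
    fix a b assume "a \<in> {z. z \<in> verts G \<and> linked G z x}" "b \<in> verts G" "adj G a b"
    then show "b \<in> {z. z \<in> verts G \<and> linked G z x}"
      using linked_trans[of G b a x] linked_step[of G b b a]
      by (auto simp: linked_refl adj_commute)
  qed (use linked_verts[OF assms] linked_refl in auto)
  then show ?thesis by simp
qed

text \<open>Only edges between vertices reachable from \<open>x\<close> are compared, so
  \<open>H\<close> may lack other vertices and edges of \<open>G\<close>.\<close>

lemma linked_mono:
  assumes "linked G x y" "x \<in> verts H"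
    and "\<And>a b. linked G x a \<Longrightarrow> linked G x b \<Longrightarrow> adj G a b \<Longrightarrow> b \<in> verts H \<and> adj H a b"
  shows "linked H x y"
proof -
  have "y \<in> {z. linked G x z \<and> linked H x z}"
    using assms(1)
  proof (rule linked_closed)
    fix a b assume "a \<in> {z. linked G x z \<and> linked H x z}" "b \<in> verts G" "adj G a b"
    then show "b \<in> {z. linked G x z \<and> linked H x z}"
      using assms(3)[of a b] linked_step[of G x a b] linked_step[of H x a b] by auto
  qed (use linked_verts[OF assms(1)] assms(2) linked_refl in auto)
  then show ?thesis by simp
qed

lemma path_linked_hd:
  assumes "is_path G p" "a \<in> set p" shows "linked G (hd p) a"
proof -
  obtain p1 p2 where "p = p1 @ a # p2" using assms(2) by (auto dest: split_list)
  then have "path_between G (hd p) (p1 @ [a]) a"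
    using assms(1) by (auto simp: path_between_def is_path_def successively_append_iff hd_append)
  then show ?thesis by (auto simp: linked_def)
qed

lemma path_subgraph:
  assumes "is_path G p" "set p \<subseteq> verts H"
    and "\<And>a b. a \<in> set p \<Longrightarrow> b \<in> set p \<Longrightarrow> adj G a b \<Longrightarrow> adj H a b"
  shows "is_path H p"
proof -
  have "successively (adj H) p"
    using assms(1,3) by (auto simp: is_path_def intro: successively_mono)
  then show ?thesis using assms by (simp add: is_path_def)
qed

lemma component_of_eq: "linked G x y \<Longrightarrow> component_of G x = component_of G y"
  by (auto simp: component_of_def intro: linked_trans linked_sym)

lemma verts_induced [simp]: "verts (induced G X) = verts G \<inter> X"
  by (simp add: induced_def)

lemma adj_induced [simp]: "adj (induced G X) a b \<longleftrightarrow> adj G a b \<and> a \<in> X \<and> b \<in> X"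
  by (auto simp: induced_def adj_def)

lemma verts_delete_verts [simp]: "verts (delete_verts G X) = verts G - X"
  by (auto simp: delete_verts_def)

lemma adj_delete_verts [simp]:
  "adj (delete_verts G X) a b \<longleftrightarrow> adj G a b \<and> a \<in> verts G - X \<and> b \<in> verts G - X"
  by (auto simp: delete_verts_def)

lemma verts_delete_edge [simp]: "verts (delete_edge G e) = verts G"
  by (simp add: delete_edge_def)

lemma adj_delete_edge [simp]: "adj (delete_edge G e) a b \<longleftrightarrow> adj G a b \<and> {a, b} \<noteq> e"
  by (auto simp: delete_edge_def adj_def)

lemma simple_graph_adjD:
  assumes "simple_graph G" "adj G x y"
  shows "x \<in> verts G" "y \<in> verts G" "x \<noteq> y"
  using assms by (auto simp: simple_graph_def adj_def)


section \<open>Edge cuts of trees\<close>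

abbreviation half :: "'t graph \<Rightarrow> 't \<Rightarrow> 't \<Rightarrow> 't set" where
  "half T x y \<equiv> component_of (delete_edge T {x, y}) x"

lemma tree_simple: "is_tree T \<Longrightarrow> simple_graph T"
  by (simp add: is_tree_def)

lemma tree_linked: "is_tree T \<Longrightarrow> x \<in> verts T \<Longrightarrow> y \<in> verts T \<Longrightarrow> linked T x y"
  by (simp add: is_tree_def connected_graph_def)

lemma half_subset_verts: "half T x y \<subseteq> verts T"
  by (auto simp: component_of_def dest: linked_verts)

lemma half_self: "x \<in> verts T \<Longrightarrow> x \<in> half T x y"
  by (simp add: component_of_def linked_refl)

lemma half_step:
  "a \<in> half T x y \<Longrightarrow> b \<in> verts T \<Longrightarrow> adj T a b \<Longrightarrow> {a, b} \<noteq> {x, y} \<Longrightarrow> b \<in> half T x y"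
  by (simp add: component_of_def linked_step)

lemma half_closed:
  assumes "z \<in> half T x y" "x \<in> A"
    and "\<And>a b. a \<in> A \<Longrightarrow> b \<in> verts T \<Longrightarrow> adj T a b \<Longrightarrow> {a, b} \<noteq> {x, y} \<Longrightarrow> b \<in> A"
  shows "z \<in> A"
proof -
  have "linked (delete_edge T {x, y}) x z" using assms(1) by (simp add: component_of_def)
  then show ?thesis by (rule linked_closed) (use assms in auto)
qed

text \<open>A path from \<open>x\<close> to \<open>y\<close> avoiding the edge \<open>xy\<close> has
  at least three vertices, and this edge closes it to a cycle.\<close>

lemma not_in_half:
  assumes "is_tree T" "adj T x y" shows "y \<notin> half T x y"
proof
  assume "y \<in> half T x y"
  then obtain p where p: "is_path (delete_edge T {x, y}) p" "hd p = x" "last p = y"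
    by (auto simp: component_of_def linked_def path_between_def)
  have "is_path T p" by (rule path_subgraph[OF p(1)]) (use p in \<open>auto simp: is_path_def\<close>)
  moreover have "x \<noteq> y" using simple_graph_adjD[OF tree_simple] assms by metis
  have "length p \<ge> 3"
  proof (rule ccontr)
    assume "\<not> length p \<ge> 3"
    then consider "p = []" | a where "p = [a]" | a b where "p = [a, b]"
      by (cases p rule: list.exhaust; cases "tl p"; cases "tl (tl p)") auto
    then show False using p \<open>x \<noteq> y\<close> by cases (auto simp: is_path_def)
  qed
  ultimately have "is_cycle T p"
    using p assms(2) by (simp add: is_cycle_def adj_commute)
  then show False using assms(1) by (auto simp: is_tree_def)
qed

lemma half_cover:
  assumes "is_tree T" "adj T x y" "z \<in> verts T"
  shows "z \<in> half T x y \<or> z \<in> half T y x"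
proof -
  note xy = simple_graph_adjD[OF tree_simple[OF assms(1)] assms(2)]
  have "z \<in> half T x y \<union> half T y x"
    using tree_linked[OF assms(1) xy(1) assms(3)]
  proof (rule linked_closed)
    fix a b assume "a \<in> half T x y \<union> half T y x" "b \<in> verts T" "adj T a b"
    then show "b \<in> half T x y \<union> half T y x"
      using half_step[of a T x y b] half_step[of a T y x b] xy half_self[of x T y] half_self[of y T x]
      by (cases "{a, b} = {x, y}") (auto simp: doubleton_eq_iff insert_commute)
  qed (simp add: half_self xy)
  then show ?thesis by simp
qed

lemma half_disjoint:
  assumes "is_tree T" "adj T x y" shows "half T x y \<inter> half T y x = {}"
proof (rule ccontr)
  assume "\<not> ?thesis"
  then obtain z where "linked (delete_edge T {x, y}) x z" "linked (delete_edge T {x, y}) y z"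
    by (auto simp: component_of_def insert_commute)
  then have "linked (delete_edge T {x, y}) x y" by (metis linked_trans linked_sym)
  then show False using not_in_half[OF assms] by (simp add: component_of_def)
qed

text \<open>A walk inside the half at \<open>x\<close> never reaches \<open>y\<close>, so it
  survives the deletion of the edge \<open>yz\<close>.\<close>

lemma half_mono:
  assumes "is_tree T" "adj T x y" "adj T y z" "z \<noteq> x"
  shows "half T x y \<subseteq> half T y z"
proof
  fix a assume "a \<in> half T x y"
  then have "a \<in> half T x y \<inter> half T y z"
  proof (rule half_closed)
    note xy = simple_graph_adjD[OF tree_simple[OF assms(1)] assms(2)]
    have "adj T y x" using assms(2) by (simp add: adj_commute)
    then have "x \<in> half T y z"
      by (intro half_step[OF half_self]) (use xy assms in \<open>auto simp: doubleton_eq_iff\<close>)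
    then show "x \<in> half T x y \<inter> half T y z" using half_self xy by simp
    fix a b assume *: "a \<in> half T x y \<inter> half T y z" "b \<in> verts T" "adj T a b" "{a, b} \<noteq> {x, y}"
    then have b: "b \<in> half T x y" by (auto intro: half_step)
    then have "a \<noteq> y" "b \<noteq> y" using * not_in_half[OF assms(1,2)] by auto
    then have "b \<in> half T y z" using * half_step[of a T y z b] by (auto simp: doubleton_eq_iff)
    then show "b \<in> half T x y \<inter> half T y z" using b by simp
  qed
  then show "a \<in> half T y z" by simp
qed

text \<open>A path leaving \<open>A\<close> through an edge \<open>xy\<close> could only return through that same edge.\<close>

lemma connected_subset_path_closed:
  assumes T: "is_tree T" and A: "A \<subseteq> verts T"
    and conn: "\<And>a b. a \<in> A \<Longrightarrow> b \<in> A \<Longrightarrow> linked (induced T A) a b"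
    and p: "path_between T s p t" and st: "s \<in> A" "t \<in> A"
  shows "set p \<subseteq> A"
proof (rule ccontr)
  assume "\<not> set p \<subseteq> A"
  then have "\<exists>x\<in>set p. x \<notin> A" by auto
  then obtain p1 y p2 where eq: "p = p1 @ y # p2" "y \<notin> A" "\<forall>z\<in>set p1. z \<in> A"
    using split_list_first_prop[of p "\<lambda>z. z \<notin> A"] by auto
  have ne: "p1 \<noteq> []" using eq p st by (auto simp: path_between_def)
  define x where "x = last p1"
  have x: "x \<in> A" "x \<in> set p1" using ne eq by (auto simp: x_def)
  have xy: "adj T x y"
    using p ne by (auto simp: path_between_def is_path_def eq successively_append_iff x_def)
  have q: "is_path T (y # p2)" "last (y # p2) = t" "x \<notin> set (y # p2)"
    using p x(2) by (auto simp: path_between_def is_path_def eq(1) successively_append_iff)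
  have "is_path (delete_edge T {x, y}) (y # p2)"
    by (rule path_subgraph[OF q(1)]) (use q in \<open>auto simp: is_path_def doubleton_eq_iff\<close>)
  from path_linked_hd[OF this, of t] have "linked (delete_edge T {x, y}) y t"
    using q(2) last_in_set[of "y # p2"] by simp
  then have "t \<in> half T y x"
    by (simp add: component_of_def insert_commute)
  moreover have "linked (delete_edge T {x, y}) x t"
  proof (rule linked_mono[OF conn[OF x(1) st(2)]])
    show "x \<in> verts (delete_edge T {x, y})" using A x by auto
    fix a b assume "linked (induced T A) x a" "linked (induced T A) x b" "adj (induced T A) a b"
    then show "b \<in> verts (delete_edge T {x, y}) \<and> adj (delete_edge T {x, y}) a b"
      using eq(2) A by (auto simp: doubleton_eq_iff)
  qed
  then have "t \<in> half T x y" by (simp add: component_of_def)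
  ultimately show False using half_disjoint[OF T xy] by auto
qed

lemma half_of_leaf:
  assumes "{u. adj T t u} = {s}" "t \<in> verts T" shows "half T t s = {t}"
proof -
  have nb: "u = s" if "adj T t u" for u using assms(1) that by blast
  have "z \<in> {t}" if "z \<in> half T t s" for z
    using that
  proof (rule half_closed)
    fix a b assume "a \<in> {t}" "adj T a b" "{a, b} \<noteq> {t, s}"
    then show "b \<in> {t}" using nb[of b] by simp
  qed simp
  then show ?thesis using half_self[OF assms(2)] by auto
qed

lemma half_of_neighbour:
  assumes "is_tree T" "t \<in> verts T" "a \<in> verts T" "a \<noteq> t"
  obtains s where "adj T t s" "a \<in> half T s t"
proof -
  obtain p where p: "is_path T p" "hd p = t" "last p = a"
    using tree_linked[OF assms(1-3)] by (auto simp: linked_def path_between_def)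
  have "p \<noteq> []" using p(1) by (simp add: is_path_def)
  then obtain q where q: "p = t # q" using p(2) by (cases p) simp_all
  have ne: "q \<noteq> []" using p(3) q assms(4) by auto
  then have s: "adj T t (hd q)" using p(1) q by (simp add: is_path_def successively_Cons)
  have q': "is_path T q" "t \<notin> set q" "last q = a"
    using p q ne by (simp_all add: is_path_def successively_Cons)
  have "is_path (delete_edge T {hd q, t}) q"
    by (rule path_subgraph[OF q'(1)]) (use q' in \<open>auto simp: is_path_def doubleton_eq_iff\<close>)
  from path_linked_hd[OF this, of a] have "a \<in> half T (hd q) t"
    using q'(3) ne last_in_set[of q] by (simp add: component_of_def)
  then show thesis using s that by blast
qed


section \<open>Orientations of rayless trees\<close>

text \<open>The halves behind successive edges increase, so the half at \<open>r n\<close> contains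
  all earlier vertices of the walk but not \<open>r (Suc n)\<close>.\<close>

lemma tree_ray_of_nonbacktracking:
  assumes T: "is_tree T" and walk: "\<And>n. adj T (r n) (r (Suc n))"
    and nb: "\<And>n. r (Suc (Suc n)) \<noteq> r n"
  shows "is_ray T r"
proof -
  note adjD = simple_graph_adjD[OF tree_simple[OF T] walk]
  have mono: "half T (r n) (r (Suc n)) \<subseteq> half T (r (Suc n)) (r (Suc (Suc n)))" for n
    by (rule half_mono) (use assms in auto)
  have mem: "r m \<in> half T (r (m + k)) (r (Suc (m + k)))" for m k
  proof (induction k)
    case (Suc k)
    then show ?case using mono[of "m + k"] by auto
  qed (simp add: half_self adjD)
  have "r m \<noteq> r n" if "m < n" for m n
  proof -
    obtain k where "n = Suc (m + k)" using \<open>m < n\<close> less_iff_Suc_add[of m n] by blast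
    then show ?thesis using mem[of m k] not_in_half[OF T walk[of "m + k"]] by auto
  qed
  then have "inj r" by (metis injI linorder_neqE_nat)
  then show ?thesis using adjD walk by (auto simp: is_ray_def)
qed

text \<open>Read \<open>D x y\<close> as: the edge points from \<open>x\<close> to \<open>y\<close>.
  Without a sink one can follow outgoing edges forever, and asymmetry forbids turning back, so the
  walk is a ray.\<close>

lemma rayless_tree_orientation_sink:
  assumes T: "is_tree T" "rayless T"
    and total: "\<And>x y. adj T x y \<Longrightarrow> D x y \<or> D y x"
    and asym: "\<And>x y. adj T x y \<Longrightarrow> \<not> (D x y \<and> D y x)"
  shows "\<exists>t\<in>verts T. \<forall>s. adj T s t \<longrightarrow> D s t"
proof (rule ccontr)
  assume "\<not> ?thesis"
  then have "\<forall>t\<in>verts T. \<exists>s. adj T t s \<and> D t s"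
    using total adj_commute by metis
  then obtain f where f: "\<And>t. t \<in> verts T \<Longrightarrow> adj T t (f t) \<and> D t (f t)" by metis
  obtain t0 where t0: "t0 \<in> verts T" using T by (auto simp: is_tree_def connected_graph_def)
  define r where "r n = (f ^^ n) t0" for n
  have rv: "r n \<in> verts T" for n
  proof (induction n)
    case (Suc n)
    then show ?case
      using f[OF Suc] simple_graph_adjD(2)[OF tree_simple[OF T(1)]] by (auto simp: r_def)
  qed (simp add: r_def t0)
  have r: "adj T (r n) (r (Suc n))" "D (r n) (r (Suc n))" for n
    using f[OF rv[of n]] by (auto simp: r_def)
  have "is_ray T r"
  proof (rule tree_ray_of_nonbacktracking[OF T(1)])
    fix n
    show "adj T (r n) (r (Suc n))" by (rule r(1))
    show "r (Suc (Suc n)) \<noteq> r n" using r[of n] r(2)[of "Suc n"] asym by metis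
  qed
  then show False using T by (auto simp: rayless_def)
qed

text \<open>By \<open>away\<close>, once an edge of a path points back to its start, all later ones
  do. On a path between two sinks the first edge points back to \<open>t\<close>, hence so does the
  last, contrary to the choice of \<open>t'\<close>.\<close>

lemma tree_orientation_sink_unique:
  assumes T: "is_tree T"
    and asym: "\<And>x y. adj T x y \<Longrightarrow> \<not> (D x y \<and> D y x)"
    and away: "\<And>x y z. adj T x y \<Longrightarrow> adj T y z \<Longrightarrow> z \<noteq> x \<Longrightarrow> D y x \<Longrightarrow> D z y"
    and t: "t \<in> verts T" "\<And>s. adj T s t \<Longrightarrow> D s t"
    and t': "t' \<in> verts T" "\<And>s. adj T s t' \<Longrightarrow> D s t'"
  shows "t = t'"
proof (rule ccontr)
  assume "t \<noteq> t'"
  obtain p where p: "is_path T p" "hd p = t" "last p = t'"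
    using tree_linked[OF T t(1) t'(1)] by (auto simp: linked_def path_between_def)
  have adjp: "adj T (p ! i) (p ! Suc i)" if "Suc i < length p" for i
    using p(1) that by (auto simp: is_path_def successively_conv_nth)
  have p0: "p ! 0 = t" using p by (auto simp: is_path_def hd_conv_nth)
  have D: "D (p ! Suc i) (p ! i)" if "Suc i < length p" for i
    using that
  proof (induction i)
    case 0
    then show ?case using adjp[of 0] t(2) p0 adj_commute by metis
  next
    case (Suc i)
    have "p ! Suc (Suc i) \<noteq> p ! i"
      using p(1) Suc.prems by (auto simp: is_path_def nth_eq_iff_index_eq)
    then show ?case using away[of "p ! i" "p ! Suc i"] adjp[of i] adjp[of "Suc i"] Suc by auto
  qed
  define k where "k = length p - 2"
  have len: "Suc k < length p" "length p = Suc (Suc k)"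
    using \<open>t \<noteq> t'\<close> p p0 by (cases p; cases "tl p"; auto simp: is_path_def k_def)+
  then have "p ! Suc k = t'" using p by (auto simp: is_path_def last_conv_nth)
  then show False using D[OF len(1)] adjp[OF len(1)] t'(2)[of "p ! k"] asym by metis
qed


section \<open>Ends and tree-decompositions\<close>

lemma has_tail_in_mono: "has_tail_in r A \<Longrightarrow> A \<subseteq> B \<Longrightarrow> has_tail_in r B"
  by (auto simp: has_tail_in_def)

lemma has_tail_in_Int:
  assumes "has_tail_in r A" "has_tail_in r B" shows "has_tail_in r (A \<inter> B)"
proof -
  obtain m n where "r ` {m..} \<subseteq> A" "r ` {n..} \<subseteq> B" using assms by (auto simp: has_tail_in_def)
  then have "r ` {max m n..} \<subseteq> A \<inter> B" by auto
  then show ?thesis by (auto simp: has_tail_in_def)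
qed

lemma has_tail_in_nonempty: "has_tail_in r A \<Longrightarrow> A \<noteq> {}"
  by (auto simp: has_tail_in_def)

lemma ray_has_tail_avoiding:
  assumes "is_ray G r" "finite X" shows "has_tail_in r (verts G - X)"
proof -
  have "finite (r -` X)" using assms by (auto simp: is_ray_def intro: finite_vimageI)
  then obtain N where N: "\<forall>n\<in>r -` X. n < N" using finite_nat_set_iff_bounded by blast
  have "r n \<in> verts G - X" if "n \<ge> N" for n
  proof -
    have "n \<notin> r -` X" using N that not_le by blast
    then show ?thesis using assms(1) by (auto simp: is_ray_def)
  qed
  then have "r ` {N..} \<subseteq> verts G - X" by auto
  then show ?thesis by (auto simp: has_tail_in_def)
qed

lemma ray_has_tail_in_component:
  assumes "is_ray G r" "finite X"
  shows "\<exists>C\<in>components (delete_verts G X). has_tail_in r C"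
proof -
  obtain N where N: "r ` {N..} \<subseteq> verts G - X"
    using ray_has_tail_avoiding[OF assms] by (auto simp: has_tail_in_def)
  then have rN: "r n \<in> verts G - X" if "n \<ge> N" for n using that by auto
  have "r n \<in> component_of (delete_verts G X) (r N)" if "n \<ge> N" for n
    using that
  proof (induction n rule: dec_induct)
    case base
    then show ?case using rN by (simp add: component_of_def linked_refl)
  next
    case (step n)
    have "adj G (r n) (r (Suc n))" using assms(1) by (simp add: is_ray_def)
    then have "adj (delete_verts G X) (r n) (r (Suc n))"
      using rN[of n] rN[of "Suc n"] step(1) by simp
    then show ?case
      using step(3) linked_step[of _ "r N" "r n" "r (Suc n)"] rN[of "Suc n"] step(1)
      by (simp add: component_of_def)
  qed
  then have "has_tail_in r (component_of (delete_verts G X) (r N))"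
    by (auto simp: has_tail_in_def)
  then show ?thesis using rN by (auto simp: components_def)
qed

lemma ray_equiv_refl: "is_ray G r \<Longrightarrow> (r, r) \<in> ray_equiv G"
  using ray_has_tail_in_component[of G r] by (simp add: ray_equiv_def)

lemma endE:
  assumes "\<omega> \<in> ends G"
  obtains r where "is_ray G r" "r \<in> \<omega>" "\<And>s. s \<in> \<omega> \<Longrightarrow> (r, s) \<in> ray_equiv G"
proof -
  obtain r where "is_ray G r" "\<omega> = ray_equiv G `` {r}"
    using assms unfolding ends_def by (rule quotientE) simp
  then show thesis using that[of r] ray_equiv_refl[of G r] by simp
qed

lemma end_of_ray:
  assumes "is_ray G r" obtains \<omega> where "\<omega> \<in> ends G" "r \<in> \<omega>"
proof
  show "ray_equiv G `` {r} \<in> ends G" unfolding ends_def by (rule quotientI) (simp add: assms)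
  show "r \<in> ray_equiv G `` {r}" using ray_equiv_refl[OF assms] by simp
qed

lemma component_subset_closed:
  assumes "C \<in> components H" "C \<inter> A \<noteq> {}"
    and "\<And>a b. a \<in> A \<Longrightarrow> b \<in> verts H \<Longrightarrow> adj H a b \<Longrightarrow> b \<in> A"
  shows "C \<subseteq> A"
proof
  fix b assume b: "b \<in> C"
  obtain c a where c: "C = component_of H c" "a \<in> C" "a \<in> A"
    using assms(1,2) by (auto simp: components_def)
  then have "linked H a b"
    using b linked_trans[OF linked_sym] by (auto simp: component_of_def)
  then show "b \<in> A" by (rule linked_closed) (use c assms(3) in auto)
qed

lemma components_eq:
  assumes "C \<in> components H" "D \<in> components H" "C \<inter> D \<noteq> {}" shows "C = D"
proof -
  have closed: "b \<in> E" if "E \<in> components H" "a \<in> E" "b \<in> verts H" "adj H a b" for E a b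
    using that linked_step[of H _ a b] by (auto simp: components_def component_of_def)
  have "C \<subseteq> D" using assms closed[OF assms(2)] by (intro component_subset_closed) auto
  moreover have "D \<subseteq> C" using assms closed[OF assms(1)] by (intro component_subset_closed) auto
  ultimately show ?thesis by simp
qed

text \<open>This justifies the definite description in \<open>end_component\<close>: components
  sharing a tail coincide, and equivalence passes the component of one ray of \<omega> to all
  others.\<close>

lemma end_component_props:
  assumes "\<omega> \<in> ends G" "finite X" "X \<subseteq> verts G"
  shows "end_component G X \<omega> \<in> components (delete_verts G X)"
    and "\<forall>r\<in>\<omega>. has_tail_in r (end_component G X \<omega>)"
proof -
  obtain r where r: "is_ray G r" "r \<in> \<omega>" "\<And>s. s \<in> \<omega> \<Longrightarrow> (r, s) \<in> ray_equiv G"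
    using endE[OF assms(1)] by blast
  let ?K = "components (delete_verts G X)"
  obtain C where C: "C \<in> ?K" "has_tail_in r C"
    using ray_has_tail_in_component[OF r(1) assms(2)] by blast
  have uniq: "D = C" if "D \<in> ?K" "has_tail_in r D" for D
    using components_eq[OF that(1) C(1)] has_tail_in_nonempty[OF has_tail_in_Int[OF that(2) C(2)]]
    by simp
  have "\<forall>s\<in>\<omega>. has_tail_in s C"
  proof
    fix s assume "s \<in> \<omega>"
    then obtain D where "D \<in> ?K" "has_tail_in r D" "has_tail_in s D"
      using r(3) assms(2,3) unfolding ray_equiv_def by blast
    then show "has_tail_in s C" using uniq by blast
  qed
  with C(1) have "C \<in> ?K \<and> (\<forall>r\<in>\<omega>. has_tail_in r C)" by simp
  then have "end_component G X \<omega> \<in> ?K \<and> (\<forall>r\<in>\<omega>. has_tail_in r (end_component G X \<omega>))"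
    unfolding end_component_def by (rule theI) (use uniq r(2) in blast)
  then show "end_component G X \<omega> \<in> ?K" "\<forall>r\<in>\<omega>. has_tail_in r (end_component G X \<omega>)"
    by simp_all
qed

section \<open>Tree edges as separations of the graph\<close>

locale tree_decomp =
  fixes G :: "'a graph" and T :: "'t graph" and \<V> :: "'t \<Rightarrow> 'a set"
  assumes td: "tree_decomposition G T \<V>"
begin

lemma T: "is_tree T" using td by (simp add: tree_decomposition_def)

lemma part_verts: "t \<in> verts T \<Longrightarrow> \<V> t \<subseteq> verts G"
  using td by (auto simp: tree_decomposition_def)

lemma adjT: "adj T x y \<Longrightarrow> x \<in> verts T \<and> y \<in> verts T \<and> x \<noteq> y"
  using simple_graph_adjD[OF tree_simple[OF T]] by blast

lemma vertex_in_part: "v \<in> verts G \<Longrightarrow> \<exists>t\<in>verts T. v \<in> \<V> t"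
  using td by (auto simp: tree_decomposition_def)

lemma edge_in_part:
  assumes "adj G v w" shows "\<exists>t\<in>verts T. v \<in> \<V> t \<and> w \<in> \<V> t"
proof -
  have "\<forall>e\<in>edges G. \<exists>t\<in>verts T. e \<subseteq> \<V> t" using td by (simp add: tree_decomposition_def)
  then have "\<exists>t\<in>verts T. {v, w} \<subseteq> \<V> t" using assms unfolding adj_def by blast
  then show ?thesis by blast
qed

lemma side_iff: "v \<in> side T \<V> x y \<longleftrightarrow> (\<exists>t\<in>half T x y. v \<in> \<V> t)"
  by (simp add: side_def)

text \<open>A path of \<open>T\<close> from one half to the other runs through both \<open>x\<close>
  and \<open>y\<close>, since otherwise it would survive the deletion of the edge
  \<open>xy\<close>.\<close>

lemma side_Int:
  assumes xy: "adj T x y" shows "side T \<V> x y \<inter> side T \<V> y x \<subseteq> \<V> x \<inter> \<V> y"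
proof
  fix v assume "v \<in> side T \<V> x y \<inter> side T \<V> y x"
  then obtain a b where a: "a \<in> half T x y" "v \<in> \<V> a" and b: "b \<in> half T y x" "v \<in> \<V> b"
    by (auto simp: side_iff)
  have "linked T a b"
    by (rule tree_linked[OF T]) (use a b half_subset_verts[of T] in blast)+
  then obtain p where p: "is_path T p" "hd p = a" "last p = b"
    by (auto simp: linked_def path_between_def)
  have "x \<in> set p \<and> y \<in> set p"
  proof (rule ccontr)
    assume "\<not> (x \<in> set p \<and> y \<in> set p)"
    then have "is_path (delete_edge T {x, y}) p"
      by (intro path_subgraph[OF p(1)]) (use p(1) in \<open>auto simp: is_path_def doubleton_eq_iff\<close>)
    moreover have "b \<in> set p" using p by (auto simp: is_path_def)
    ultimately have "linked (delete_edge T {x, y}) a b" using path_linked_hd p(2) by fastforce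
    then have "b \<in> half T x y" using a(1) linked_trans[of _ x a b] by (simp add: component_of_def)
    then show False using b(1) half_disjoint[OF T xy] by blast
  qed
  moreover have "path_between T a p b" using p by (simp add: path_between_def)
  moreover have "\<forall>t\<^sub>1 t\<^sub>3 p. path_between T t\<^sub>1 p t\<^sub>3 \<longrightarrow> (\<forall>t\<^sub>2\<in>set p. \<V> t\<^sub>1 \<inter> \<V> t\<^sub>3 \<subseteq> \<V> t\<^sub>2)"
    using td by (simp add: tree_decomposition_def)
  ultimately have "\<V> a \<inter> \<V> b \<subseteq> \<V> x" "\<V> a \<inter> \<V> b \<subseteq> \<V> y" by blast+
  then show "v \<in> \<V> x \<inter> \<V> y" using a b by blast
qed

lemma side_cover:
  assumes "adj T x y" "v \<in> verts G" shows "v \<in> side T \<V> x y \<union> side T \<V> y x"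
  using vertex_in_part[OF assms(2)] half_cover[OF T assms(1)] by (auto simp: side_iff)

lemma side_mono:
  assumes "adj T x y" "adj T y z" "z \<noteq> x" shows "side T \<V> x y \<subseteq> side T \<V> y z"
  using half_mono[OF T assms] by (auto simp: side_def)

definition strict_side :: "'t \<Rightarrow> 't \<Rightarrow> 'a set" where
  "strict_side x y = side T \<V> x y - side T \<V> y x"

text \<open>Some part contains both \<open>v\<close> and \<open>w\<close>, and as \<open>v\<close>
  is on one side only, its node lies in the half at \<open>x\<close>. So a strict side can be left
  only through the separator; all later arguments about tails rest on this.\<close>

lemma strict_side_step:
  assumes xy: "adj T x y" and v: "v \<in> strict_side x y"
    and "adj G v w" "w \<notin> \<V> x \<inter> \<V> y"
  shows "w \<in> strict_side x y"
proof -
  obtain t where t: "t \<in> verts T" "v \<in> \<V> t" "w \<in> \<V> t" using edge_in_part assms by blast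
  then have "t \<in> half T x y"
    using half_cover[OF T xy t(1)] v by (auto simp: strict_side_def side_iff)
  then have "w \<in> side T \<V> x y" using t(3) by (auto simp: side_iff)
  then show ?thesis using side_Int[OF xy] assms(4) by (auto simp: strict_side_def)
qed

lemma ray_tail_in_strict_side:
  assumes xy: "adj T x y" and fin: "finite (\<V> x \<inter> \<V> y)" and r: "is_ray G r"
  shows "has_tail_in r (strict_side x y) \<or> has_tail_in r (strict_side y x)"
proof -
  obtain N where N: "r ` {N..} \<subseteq> verts G - \<V> x \<inter> \<V> y"
    using ray_has_tail_avoiding[OF r fin] by (auto simp: has_tail_in_def)
  have yx: "adj T y x" using xy by (simp add: adj_commute)
  have tail: "has_tail_in r (strict_side a b)"
    if ab: "adj T a b" "\<V> a \<inter> \<V> b = \<V> x \<inter> \<V> y" "r N \<in> strict_side a b" for a b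
  proof -
    have "r n \<in> strict_side a b" if "n \<ge> N" for n
      using that
    proof (induction n rule: dec_induct)
      case (step n)
      have "r (Suc n) \<notin> \<V> a \<inter> \<V> b" unfolding ab(2) using N step(1) by (auto simp: image_subset_iff)
      moreover have "adj G (r n) (r (Suc n))" using r by (simp add: is_ray_def)
      ultimately show ?case using strict_side_step[OF ab(1) step(3)] by blast
    qed (rule ab(3))
    then show ?thesis by (auto simp: has_tail_in_def)
  qed
  have rN: "r N \<in> verts G" "r N \<notin> \<V> x \<inter> \<V> y" using N by auto
  then have "r N \<in> strict_side x y \<or> r N \<in> strict_side y x"
    using side_cover[OF xy rN(1)] side_Int[OF xy] by (auto simp: strict_side_def)
  then show ?thesis using tail[OF xy] tail[OF yx] by (auto simp: Int_commute)
qed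

lemma orients_towards_iff:
  "orients_towards T \<V> \<omega> x y \<longleftrightarrow> (\<forall>r\<in>\<omega>. has_tail_in r (strict_side y x))"
  by (simp add: orients_towards_def strict_side_def)

text \<open>Orienting requires all rays of \<omega> to go to the same side. They have tails in one
  common component of \<open>G\<close> minus the separator, and this component lies in one strict
  side, so a single ray decides.\<close>

lemma end_orients_total:
  assumes xy: "adj T x y" and fin: "finite (\<V> x \<inter> \<V> y)" and \<omega>: "\<omega> \<in> ends G"
  shows "orients_towards T \<V> \<omega> x y \<or> orients_towards T \<V> \<omega> y x"
proof -
  let ?X = "\<V> x \<inter> \<V> y"
  have X: "?X \<subseteq> verts G" using adjT[OF xy] part_verts by blast
  obtain r where r: "is_ray G r" "r \<in> \<omega>" using endE[OF \<omega>] by blast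
  note C = end_component_props[OF \<omega> fin X]
  have tails: "\<forall>s\<in>\<omega>. has_tail_in s (strict_side a b)"
    if ab: "adj T a b" "\<V> a \<inter> \<V> b = ?X" "has_tail_in r (strict_side a b)" for a b
  proof -
    have "end_component G ?X \<omega> \<inter> strict_side a b \<noteq> {}"
      by (rule has_tail_in_nonempty[OF has_tail_in_Int]) (use C(2) r(2) ab(3) in auto)
    then have "end_component G ?X \<omega> \<subseteq> strict_side a b"
    proof (rule component_subset_closed[OF C(1)])
      fix v w assume "v \<in> strict_side a b" "w \<in> verts (delete_verts G ?X)" "adj (delete_verts G ?X) v w"
      then show "w \<in> strict_side a b" using strict_side_step[OF ab(1), of v w] ab(2) by auto
    qed
    then show ?thesis using C(2) has_tail_in_mono by blast
  qed
  have yx: "adj T y x" using xy by (simp add: adj_commute)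
  show ?thesis
    using ray_tail_in_strict_side[OF xy fin r(1)] tails[OF xy] tails[OF yx]
    by (auto simp: orients_towards_iff Int_commute)
qed

lemma end_orients_asym:
  assumes "\<omega> \<in> ends G"
  shows "\<not> (orients_towards T \<V> \<omega> x y \<and> orients_towards T \<V> \<omega> y x)"
proof
  assume *: "orients_towards T \<V> \<omega> x y \<and> orients_towards T \<V> \<omega> y x"
  obtain r where "r \<in> \<omega>" using endE[OF assms] by blast
  then have "has_tail_in r (strict_side x y \<inter> strict_side y x)"
    using * by (intro has_tail_in_Int) (auto simp: orients_towards_iff)
  moreover have "strict_side x y \<inter> strict_side y x = {}" by (auto simp: strict_side_def)
  ultimately show False using has_tail_in_nonempty by metis
qed

text \<open>Otherwise \<omega> would point from \<open>y\<close> to both \<open>x\<close> and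
  \<open>z\<close>, but the strict sides at \<open>x\<close> and \<open>z\<close> are disjoint
  because the sides are nested.\<close>

lemma end_orients_away:
  assumes \<omega>: "\<omega> \<in> ends G" and adj: "adj T x y" "adj T y z" "z \<noteq> x"
    and fin: "finite (\<V> y \<inter> \<V> z)" and o: "orients_towards T \<V> \<omega> y x"
  shows "orients_towards T \<V> \<omega> z y"
proof (rule ccontr)
  assume "\<not> ?thesis"
  then have o': "orients_towards T \<V> \<omega> y z" using end_orients_total[OF adj(2) fin \<omega>] by blast
  obtain r where "r \<in> \<omega>" using endE[OF \<omega>] by blast
  then have "has_tail_in r (strict_side x y \<inter> strict_side z y)"
    using o o' by (intro has_tail_in_Int) (auto simp: orients_towards_iff)
  moreover have "strict_side x y \<inter> strict_side z y = {}"
    using side_mono[OF adj] by (auto simp: strict_side_def)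
  ultimately show False using has_tail_in_nonempty by metis
qed

text \<open>A tail avoiding the part at \<open>t\<close> stays in one branch at \<open>t\<close>,
  since leaving the branch means passing through a separator contained in that part. The edge to
  this branch then cannot be oriented towards \<open>t\<close>.\<close>

lemma not_lives_at_finite_part:
  assumes \<omega>: "\<omega> \<in> ends G" and lives: "lives_at T \<V> \<omega> t" and fin: "finite (\<V> t)"
  shows False
proof -
  have t: "t \<in> verts T" using lives by (simp add: lives_at_def)
  obtain r where r: "is_ray G r" "r \<in> \<omega>" using endE[OF \<omega>] by blast
  obtain N where N: "r ` {N..} \<subseteq> verts G - \<V> t"
    using ray_has_tail_avoiding[OF r(1) fin] by (auto simp: has_tail_in_def)
  then have rN: "r n \<notin> \<V> t" if "n \<ge> N" for n using that by auto
  obtain a where a: "a \<in> verts T" "r N \<in> \<V> a" using N vertex_in_part[of "r N"] by auto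
  then have "a \<noteq> t" using rN by auto
  then obtain s where s: "adj T t s" "a \<in> half T s t"
    using half_of_neighbour[OF T t a(1)] by blast
  have st: "adj T s t" using s by (simp add: adj_commute)
  have "r n \<in> side T \<V> s t" if "n \<ge> N" for n
    using that
  proof (induction n rule: dec_induct)
    case base
    show ?case using a s(2) by (auto simp: side_iff)
  next
    case (step n)
    have "r n \<in> strict_side s t"
      using step(3) side_Int[OF st] rN[OF step(1)] by (auto simp: strict_side_def)
    moreover have "adj G (r n) (r (Suc n))" using r by (simp add: is_ray_def)
    moreover have "r (Suc n) \<notin> \<V> s \<inter> \<V> t" using rN[of "Suc n"] step(1) by simp
    ultimately have "r (Suc n) \<in> strict_side s t" by (rule strict_side_step[OF st])
    then show ?case by (simp add: strict_side_def)
  qed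
  then have "has_tail_in r (side T \<V> s t)" by (auto simp: has_tail_in_def)
  moreover have "has_tail_in r (strict_side t s)"
    using lives st r(2) by (auto simp: lives_at_def orients_towards_iff)
  ultimately have "has_tail_in r (side T \<V> s t \<inter> strict_side t s)" by (rule has_tail_in_Int)
  then show False using has_tail_in_nonempty by (force simp: strict_side_def)
qed

end

lemma inj_on_disjoint_lists:
  assumes disj: "pairwise (\<lambda>p q. set p \<inter> set q = {}) P" and "Q \<subseteq> P"
    and f: "\<And>p. p \<in> Q \<Longrightarrow> f p \<in> set p"
  shows "inj_on f Q"
proof (rule inj_onI)
  fix p q assume pq: "p \<in> Q" "q \<in> Q" "f p = f q"
  then have "f p \<in> set p \<inter> set q" using f[of p] f[of q] by simp
  then show "p = q" using pairwiseD[OF disj, of p q] pq assms(2) by blast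
qed

lemma finite_disjoint_lists_meeting:
  assumes disj: "pairwise (\<lambda>p q. set p \<inter> set q = {}) P" and "finite X"
  shows "finite {p \<in> P. set p \<inter> X \<noteq> {}}"
proof -
  let ?Q = "{p \<in> P. set p \<inter> X \<noteq> {}}"
  have "\<forall>p\<in>?Q. \<exists>x. x \<in> set p \<inter> X" by auto
  then obtain f where f: "\<And>p. p \<in> ?Q \<Longrightarrow> f p \<in> set p \<inter> X" by (metis (lifting))
  have "inj_on f ?Q"
    by (rule inj_on_disjoint_lists[OF disj]) (use f in auto)
  moreover have "f ` ?Q \<subseteq> X" using f by blast
  ultimately show ?thesis using inj_on_finite \<open>finite X\<close> by blast
qed

section \<open>Ends and combs in a rayless decomposition\<close>

locale rayless_decomp = tree_decomp +
  fixes U :: "'a set"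
  assumes rd: "rayless_decomposition_for G U T \<V>" and fs: "finite_separators T \<V>"
begin

lemma finite_sep: "adj T x y \<Longrightarrow> finite (\<V> x \<inter> \<V> y)"
  using fs by (auto simp: finite_separators_def separators_def)

lemma rayless: "rayless T"
  using rd by (simp add: rayless_decomposition_for_def)

lemma lives_at_unique_node:
  assumes \<omega>: "\<omega> \<in> ends G" shows "\<exists>!t. lives_at T \<V> \<omega> t"
proof -
  let ?D = "orients_towards T \<V> \<omega>"
  have "\<exists>t\<in>verts T. \<forall>s. adj T s t \<longrightarrow> ?D s t"
    by (rule rayless_tree_orientation_sink[OF T rayless])
      (use end_orients_total[OF _ finite_sep \<omega>] end_orients_asym[OF \<omega>] in blast)+
  moreover have "t = t'" if "lives_at T \<V> \<omega> t" "lives_at T \<V> \<omega> t'" for t t'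
  proof (rule tree_orientation_sink_unique[OF T, of ?D])
    fix x y z assume "adj T x y" "adj T y z" "z \<noteq> x" "?D y x"
    then show "?D z y" using end_orients_away[OF \<omega>] finite_sep by blast
  qed (use that end_orients_asym[OF \<omega>] in \<open>auto simp: lives_at_def\<close>)
  ultimately show ?thesis by (auto simp: lives_at_def)
qed

lemma lives_at_leaf:
  assumes \<omega>: "\<omega> \<in> ends G" and lives: "lives_at T \<V> \<omega> t"
  obtains s where "adj T t s" "side T \<V> t s = \<V> t"
proof -
  have t: "t \<in> verts T" using lives by (simp add: lives_at_def)
  have "leaf T t"
    using not_lives_at_finite_part[OF \<omega> lives] rd t by (auto simp: rayless_decomposition_for_def)
  then obtain s where s: "{u. adj T t u} = {s}" by (auto simp: leaf_def card_1_singleton_iff)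
  then have "adj T t s" by blast
  moreover have "side T \<V> t s = \<V> t" using half_of_leaf[OF s t] by (simp add: side_def)
  ultimately show thesis using that by blast
qed

text \<open>The end of the spine lives at a leaf \<open>t\<close>. All but finitely many of the
  attached paths start in the strict side of \<open>t\<close> and avoid the separator, so their
  teeth lie in \<open>\<V> t \<inter> U\<close>. By disjointness these teeth are infinitely
  many.\<close>

lemma no_comb: "\<not> has_comb_attached_to G U"
proof
  assume "has_comb_attached_to G U"
  then obtain r P where comb: "is_comb G r P" and teeth: "teeth P \<subseteq> U"
    by (auto simp: has_comb_attached_to_def)
  have r: "is_ray G r" and infP: "infinite P" and disj: "pairwise (\<lambda>p q. set p \<inter> set q = {}) P"
    and P: "\<And>p. p \<in> P \<Longrightarrow> is_path G p" "\<And>p. p \<in> P \<Longrightarrow> set p \<inter> range r = {hd p}"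
    using comb unfolding is_comb_def by blast+
  have ne: "p \<noteq> []" if "p \<in> P" for p using P(1)[OF that] by (simp add: is_path_def)
  obtain \<omega> where \<omega>: "\<omega> \<in> ends G" "r \<in> \<omega>" using end_of_ray[OF r] by blast
  then obtain t where t: "lives_at T \<V> \<omega> t" using lives_at_unique_node by blast
  then obtain s where s: "adj T t s" "side T \<V> t s = \<V> t" using lives_at_leaf \<omega> by blast
  have "adj T s t" using s by (simp add: adj_commute)
  then have "has_tail_in r (strict_side t s)"
    using t \<omega>(2) by (auto simp: lives_at_def orients_towards_iff)
  then obtain N where N: "r ` {N..} \<subseteq> strict_side t s" by (auto simp: has_tail_in_def)
  define X where "X = r ` {..<N} \<union> \<V> t \<inter> \<V> s"
  have "finite X" using finite_sep[OF s(1)] by (simp add: X_def)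
  then have fin: "finite {p \<in> P. set p \<inter> X \<noteq> {}}"
    by (rule finite_disjoint_lists_meeting[OF disj])
  have inf: "infinite {p \<in> P. set p \<inter> X = {}}"
  proof
    assume "finite {p \<in> P. set p \<inter> X = {}}"
    with fin have "finite ({p \<in> P. set p \<inter> X \<noteq> {}} \<union> {p \<in> P. set p \<inter> X = {}})" by simp
    then have "finite P" by (rule rev_finite_subset) blast
    then show False using infP by simp
  qed
  have "last p \<in> \<V> t \<inter> U" if p: "p \<in> P" "set p \<inter> X = {}" for p
  proof -
    have "hd p \<in> range r" "hd p \<in> set p" using P(2)[OF p(1)] by blast+
    then obtain n where n: "hd p = r n" by blast
    have "\<not> n < N" using p(2) n \<open>hd p \<in> set p\<close> by (auto simp: X_def)
    then have hd: "hd p \<in> strict_side t s" using N n by (simp add: image_subset_iff)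
    have "linked (induced G (set p)) (hd p) (last p)"
    proof -
      have "is_path (induced G (set p)) p"
        by (rule path_subgraph[OF P(1)[OF p(1)]]) (use P(1)[OF p(1)] in \<open>auto simp: is_path_def\<close>)
      then show ?thesis using path_linked_hd[OF _ last_in_set[OF ne[OF p(1)]]] by blast
    qed
    then have "last p \<in> strict_side t s"
    proof (rule linked_closed[OF _ hd])
      fix a b assume "a \<in> strict_side t s" "b \<in> verts (induced G (set p))" "adj (induced G (set p)) a b"
      then show "b \<in> strict_side t s"
        using strict_side_step[OF s(1), of a b] p(2) by (auto simp: X_def)
    qed
    moreover have "last p \<in> U" using teeth p(1) by (auto simp: teeth_def)
    ultimately show ?thesis using s(2) by (auto simp: strict_side_def)
  qed
  then have "last ` {p \<in> P. set p \<inter> X = {}} \<subseteq> \<V> t \<inter> U" by blast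
  moreover have "finite (\<V> t \<inter> U)"
    using rd t by (auto simp: rayless_decomposition_for_def lives_at_def)
  ultimately have "finite (last ` {p \<in> P. set p \<inter> X = {}})" by (rule finite_subset)
  moreover have "inj_on last {p \<in> P. set p \<inter> X = {}}"
    by (rule inj_on_disjoint_lists[OF disj]) (use ne in auto)
  ultimately show False using inf finite_imageD[of last] by blast
qed

lemma boundary_ends_empty:
  assumes "U \<subseteq> verts G" shows "boundary_ends G U = {}"
proof (rule ccontr)
  assume "boundary_ends G U \<noteq> {}"
  then obtain \<omega> where \<omega>: "\<omega> \<in> ends G"
    and meets: "\<And>X. finite X \<Longrightarrow> X \<subseteq> verts G \<Longrightarrow> end_component G X \<omega> \<inter> U \<noteq> {}"
    by (auto simp: boundary_ends_def)
  obtain t where t: "lives_at T \<V> \<omega> t" using lives_at_unique_node[OF \<omega>] by blast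
  then obtain s where s: "adj T t s" "side T \<V> t s = \<V> t" using lives_at_leaf \<omega> by blast
  have tv: "t \<in> verts T" using t by (simp add: lives_at_def)
  \<comment> \<open>The separator together with the vertices of \<open>U\<close> in the leaf part;
    deleting this finite set traps the end inside \<open>\<V> t\<close>, away from
    \<open>U\<close>.\<close>
  define X where "X = \<V> t \<inter> (\<V> s \<union> U)"
  have X: "finite X" "X \<subseteq> verts G"
    using finite_sep[OF s(1)] rd tv part_verts[OF tv]
    by (auto simp: X_def Int_Un_distrib rayless_decomposition_for_def)
  note C = end_component_props[OF \<omega> X]
  obtain r where r: "r \<in> \<omega>" using endE[OF \<omega>] by blast
  have st: "adj T s t" using s by (simp add: adj_commute)
  then have "has_tail_in r (strict_side t s)"
    using t r by (auto simp: lives_at_def orients_towards_iff)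
  then have "end_component G X \<omega> \<inter> strict_side t s \<noteq> {}"
    using C(2) r has_tail_in_Int has_tail_in_nonempty by metis
  then have "end_component G X \<omega> \<subseteq> strict_side t s"
  proof (rule component_subset_closed[OF C(1)])
    fix a b assume "a \<in> strict_side t s" "b \<in> verts (delete_verts G X)" "adj (delete_verts G X) a b"
    then show "b \<in> strict_side t s"
      using strict_side_step[OF s(1), of a b] by (auto simp: X_def)
  qed
  then have "end_component G X \<omega> \<subseteq> \<V> t" using s(2) by (auto simp: strict_side_def)
  moreover have "end_component G X \<omega> \<inter> X = {}"
    using C(1) linked_verts[of "delete_verts G X"]
    by (auto simp: components_def component_of_def)
  ultimately show False using meets[OF X] by (auto simp: X_def)
qed

text \<open>Both \<open>boundary_ends G U\<close> and \<open>ends T\<close> are empty, so the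
  bijection is trivial. What remains is that \<open>end_map\<close> takes the unique node at which
  \<omega> lives as its value.\<close>

lemma displays_boundary_ends:
  assumes "U \<subseteq> verts G" shows "displays G T \<V> (boundary_ends G U)"
proof -
  have no_ends: "ends T = {}" using rayless by (auto simp: ends_def rayless_def quotient_def)
  have "end_map T \<V> \<omega> \<in> Inr ` verts T" if \<omega>: "\<omega> \<in> ends G" for \<omega>
  proof -
    obtain t where t: "lives_at T \<V> \<omega> t" "\<And>t'. lives_at T \<V> \<omega> t' \<Longrightarrow> t' = t"
      using lives_at_unique_node[OF \<omega>] by blast
    have "end_map T \<V> \<omega> = Inr t"
      unfolding end_map_def
    proof (rule the_equality)
      fix z
      assume "case z of Inl \<eta> \<Rightarrow> corresponds_to T \<V> \<omega> \<eta> | Inr t \<Rightarrow> lives_at T \<V> \<omega> t"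
      then show "z = Inr t"
        using t(2) no_ends by (auto simp: corresponds_to_def split: sum.splits)
    qed (simp add: t(1))
    then show ?thesis using t(1) by (auto simp: lives_at_def)
  qed
  then show ?thesis
    by (auto simp: displays_def boundary_ends_empty[OF assms] no_ends bij_betw_def)
qed

end

lemma rayless_decomp_intro:
  assumes "rayless_decomposition_for G U T \<V>" "finite_separators T \<V>"
  shows "rayless_decomp G T \<V> U"
  using assms by unfold_locales (auto simp: rayless_decomposition_for_def)

text \<open>A separator can be infinite only between two leaves, and these are then all of \<open>T\<close>.\<close>

lemma rayless_decomposition_no_comb:
  assumes rd: "rayless_decomposition_for G U T \<V>" and U: "U \<subseteq> verts G"
  shows "\<not> has_comb_attached_to G U"
proof (cases "finite_separators T \<V>")
  case True
  then show ?thesis using rayless_decomp.no_comb[OF rayless_decomp_intro[OF rd]] by blast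
next
  case False
  interpret tree_decomp G T \<V> using rd by unfold_locales (simp add: rayless_decomposition_for_def)
  obtain x y where xy: "adj T x y" "infinite (\<V> x \<inter> \<V> y)"
    using False by (auto simp: finite_separators_def separators_def)
  have yx: "adj T y x" using xy by (simp add: adj_commute)
  have nonleaf: "finite (\<V> t)" if "t \<in> verts T" "\<not> leaf T t" for t
    using rd that by (auto simp: rayless_decomposition_for_def)
  have half: "half T a b = {a}" if "adj T a b" "infinite (\<V> a)" for a b
  proof -
    have "leaf T a" using that nonleaf adjT by blast
    then obtain s where s: "{u. adj T a u} = {s}" by (auto simp: leaf_def card_1_singleton_iff)
    moreover have "b \<in> {u. adj T a u}" using that(1) by simp
    then have "s = b" unfolding s by simp
    ultimately show ?thesis using half_of_leaf adjT[OF that(1)] by metis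
  qed
  have "verts T \<subseteq> {x, y}"
    using half_cover[OF T xy(1)] half[OF xy(1)] half[OF yx] xy(2) by blast
  then have "U \<subseteq> (\<V> x \<inter> U) \<union> (\<V> y \<inter> U)" using U vertex_in_part by blast
  moreover have "finite (\<V> x \<inter> U)" "finite (\<V> y \<inter> U)"
    using rd adjT[OF xy(1)] by (auto simp: rayless_decomposition_for_def)
  ultimately have "finite U" by (meson finite_Un finite_subset)
  show ?thesis
  proof
    assume "has_comb_attached_to G U"
    then obtain r P where comb: "is_comb G r P" and teeth: "last ` P \<subseteq> U"
      by (auto simp: has_comb_attached_to_def teeth_def)
    have ne: "p \<noteq> []" if "p \<in> P" for p using comb that by (auto simp: is_comb_def is_path_def)
    have "pairwise (\<lambda>p q. set p \<inter> set q = {}) P" using comb by (simp add: is_comb_def)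
    then have "inj_on last P" by (rule inj_on_disjoint_lists) (use ne in auto)
    moreover have "infinite P" using comb by (simp add: is_comb_def)
    ultimately show False using teeth \<open>finite U\<close> finite_imageD finite_subset by blast
  qed
qed


section \<open>A comb from a sequence of linked disjoint paths\<close>

text \<open>The spine runs along each path \<open>p n\<close> only up to the vertex from which \<open>p (Suc n)\<close> is
  reached; the remainders of the paths are attached to it.\<close>

lemma comb_of_linked_paths:
  fixes p :: "nat \<Rightarrow> 'a list"
  assumes path: "\<And>n. is_path G (p n)"
    and disj: "\<And>m n. m < n \<Longrightarrow> set (p m) \<inter> set (p n) = {}"
    and tooth: "\<And>n. last (p n) \<in> U"
    and link: "\<And>n. \<exists>y\<in>set (p n). adj G y (hd (p (Suc n)))"
  shows "has_comb_attached_to G U"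
proof -
  obtain y where y: "\<And>n. y n \<in> set (p n)" "\<And>n. adj G (y n) (hd (p (Suc n)))"
    using link by metis
  have "\<forall>n. \<exists>q s. p n = q @ y n # s" using y(1) split_list by metis
  then obtain q s where p_eq: "\<And>n. p n = q n @ y n # s n" by metis
  define a b where "a n = q n @ [y n]" and "b n = y n # s n" for n
  have a_ne: "a n \<noteq> []" and hd_a: "hd (a n) = hd (p n)" and last_a: "last (a n) = y n" for n
    by (simp_all add: a_def p_eq hd_append)
  have path_a: "is_path G (a n)" and path_b: "is_path G (b n)" for n
    using path[of n] by (auto simp: a_def b_def p_eq is_path_def successively_append_iff)
  have set_a: "set (a n) \<subseteq> set (p n)" and set_b: "set (b n) \<subseteq> set (p n)" for n
    by (auto simp: a_def b_def p_eq)
  have ab: "set (b n) \<inter> set (a n) = {y n}" for n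
    using path[of n] by (auto simp: a_def b_def p_eq is_path_def)
  have disj': "set (p m) \<inter> set (p n) = {}" if "m \<noteq> n" for m n
    using disj[of m n] disj[of n m] that by (cases m n rule: linorder_cases) auto
  define L where "L n = concat (map a [0..<n])" for n
  have L_Suc: "L (Suc n) = L n @ a n" for n by (simp add: L_def)
  have set_L: "set (L n) = (\<Union>m<n. set (a m))" for n by (auto simp: L_def)
  have len_L: "n \<le> length (L n)" for n
  proof (induction n)
    case (Suc n)
    have "length (a n) > 0" using a_ne by simp
    then show ?case using Suc unfolding L_Suc length_append by linarith
  qed simp
  have dist_L: "distinct (L n)" for n
  proof (induction n)
    case (Suc n)
    have "set (a m) \<inter> set (a n) = {}" if "m < n" for m
      using disj[OF that] set_a[of m] set_a[of n] by blast
    then have "set (L n) \<inter> set (a n) = {}" by (auto simp: set_L)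
    then show ?case using Suc path_a[of n] by (simp add: L_Suc is_path_def)
  qed (simp add: L_def)
  have last_L: "last (L (Suc n)) = y n" for n using a_ne[of n] last_a[of n] by (simp add: L_Suc)
  have succ_L: "successively (adj G) (L n)" for n
  proof (induction n)
    case (Suc n)
    have "L n = [] \<or> adj G (last (L n)) (hd (a n))"
    proof (cases n)
      case (Suc k)
      then show ?thesis using last_L[of k] y(2)[of k] hd_a[of n] by simp
    qed (simp add: L_def)
    then show ?case
      using Suc path_a[of n] by (auto simp: L_Suc successively_append_iff is_path_def)
  qed (simp add: L_def)
  have L_prefix: "L n ! i = L k ! i" if "k \<le> n" "i < length (L k)" for i k n
    using that(1)
  proof (induction n rule: dec_induct)
    case (step n)
    have "length (L k) \<le> length (L n)"
      using step(1) by (induction n rule: dec_induct) (auto simp: L_Suc)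
    then have "i < length (L n)" using that(2) by linarith
    then show ?case using step(3) by (simp add: L_Suc nth_append)
  qed simp
  \<comment> \<open>The spine is the limit of the lists \<open>L n\<close>, each a prefix of the
    next. As every segment is nonempty, \<open>L (Suc m)\<close> has an entry at position
    \<open>m\<close>, and all longer lists agree with it there.\<close>
  define r where "r m = L (Suc m) ! m" for m
  have r_eq: "r i = L k ! i" if "i < length (L k)" for i k
    using L_prefix[of k "Suc i" i] L_prefix[of "Suc i" k i] len_L[of "Suc i"] that
    by (cases "k \<le> Suc i") (auto simp: r_def)
  have range_r: "range r = (\<Union>n. set (a n))"
  proof
    show "range r \<subseteq> (\<Union>n. set (a n))"
    proof
      fix x assume "x \<in> range r"
      then obtain m where "x = L (Suc m) ! m" by (auto simp: r_def)
      then have "x \<in> set (L (Suc m))" using len_L[of "Suc m"] by (auto intro: nth_mem)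
      then show "x \<in> (\<Union>n. set (a n))" unfolding set_L by blast
    qed
    show "(\<Union>n. set (a n)) \<subseteq> range r"
    proof
      fix x assume "x \<in> (\<Union>n. set (a n))"
      then obtain n where "x \<in> set (L (Suc n))" by (auto simp: L_Suc)
      then obtain i where "i < length (L (Suc n))" "L (Suc n) ! i = x" by (auto simp: in_set_conv_nth)
      then have "r i = x" using r_eq by blast
      then show "x \<in> range r" by blast
    qed
  qed
  have "is_ray G r"
    unfolding is_ray_def
  proof (intro conjI allI)
    show "inj r"
    proof (rule injI)
      fix m n assume eq: "r m = r n"
      have "m < length (L (Suc (m + n)))" "n < length (L (Suc (m + n)))"
        using len_L[of "Suc (m + n)"] by linarith+
      then show "m = n" using eq r_eq dist_L nth_eq_iff_index_eq by metis
    qed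
    show "range r \<subseteq> verts G" using path_a by (auto simp: range_r is_path_def)
    fix n
    have "Suc n < length (L (Suc (Suc n)))" using len_L[of "Suc (Suc n)"] by linarith
    then show "adj G (r n) (r (Suc n))"
      using succ_L[of "Suc (Suc n)"] r_eq[of n "Suc (Suc n)"] r_eq[of "Suc n" "Suc (Suc n)"]
      by (simp add: successively_conv_nth)
  qed
  moreover have disj_b: "set (b m) \<inter> set (b n) = {}" if "m \<noteq> n" for m n
    using disj'[OF that] set_b[of m] set_b[of n] by blast
  moreover have "infinite (range b)"
  proof
    assume "finite (range b)"
    moreover have "inj b"
    proof (rule injI)
      fix m n assume "b m = b n"
      then have "y m \<in> set (b m) \<inter> set (b n)" by (simp add: b_def)
      then show "m = n" using disj_b[of m n] by blast
    qed
    ultimately show False using finite_imageD infinite_UNIV_nat by blast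
  qed
  moreover have "set (b n) \<inter> range r = {hd (b n)}" for n
  proof -
    have "x \<in> set (a n)" if "x \<in> set (b n)" "x \<in> set (a m)" for x m
      using that disj'[of m n] set_a[of m] set_b[of n] by (cases "m = n") auto
    then have "set (b n) \<inter> range r = set (b n) \<inter> set (a n)" unfolding range_r by blast
    then show ?thesis using ab by (simp add: b_def)
  qed
  moreover have "pairwise (\<lambda>p q. set p \<inter> set q = {}) (range b)"
  proof (rule pairwiseI)
    fix p q assume "p \<in> range b" "q \<in> range b" "p \<noteq> q"
    then obtain m n where "p = b m" "q = b n" "m \<noteq> n" by blast
    then show "set p \<inter> set q = {}" using disj_b by simp
  qed
  ultimately have "is_comb G r (range b)"
    using path_b unfolding is_comb_def by blast
  moreover have "teeth (range b) \<subseteq> U" using tooth by (auto simp: teeth_def b_def p_eq)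
  ultimately show ?thesis by (auto simp: has_comb_attached_to_def)
qed

text \<open>By disjointness only finitely many of the paths contain \<open>v\<close>; dropping them
  leaves a comb whose teeth avoid \<open>v\<close>.\<close>

lemma comb_attached_to_insert:
  assumes "has_comb_attached_to G (insert v U)" shows "has_comb_attached_to G U"
proof -
  obtain r P where comb: "is_comb G r P" and teeth: "last ` P \<subseteq> insert v U"
    using assms by (auto simp: has_comb_attached_to_def teeth_def)
  have disj: "pairwise (\<lambda>p q. set p \<inter> set q = {}) P" using comb by (simp add: is_comb_def)
  have ne: "p \<noteq> []" if "p \<in> P" for p using comb that by (auto simp: is_comb_def is_path_def)
  have "finite {p \<in> P. set p \<inter> {v} \<noteq> {}}" by (rule finite_disjoint_lists_meeting[OF disj]) simp
  then have "infinite (P - {p \<in> P. set p \<inter> {v} \<noteq> {}})"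
    using comb by (simp add: is_comb_def)
  then have "is_comb G r (P - {p \<in> P. set p \<inter> {v} \<noteq> {}})"
    using comb pairwise_subset[OF disj, of "P - {p \<in> P. set p \<inter> {v} \<noteq> {}}"]
    unfolding is_comb_def by blast
  moreover have "last p \<in> U" if p: "p \<in> P - {p \<in> P. set p \<inter> {v} \<noteq> {}}" for p
  proof -
    have "last p \<in> set p" using ne p by simp
    then have "last p \<noteq> v" using p by blast
    then show ?thesis using teeth p by blast
  qed
  ultimately show ?thesis unfolding has_comb_attached_to_def teeth_def by blast
qed


section \<open>Trees given by a parent function\<close>

locale parent_tree =
  fixes N :: "'t set" and parent :: "'t \<Rightarrow> 't" and depth :: "'t \<Rightarrow> nat" and root :: 't
  assumes root: "root \<in> N" and root_unique: "x \<in> N \<Longrightarrow> depth x = 0 \<Longrightarrow> x = root"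
    and parent: "x \<in> N \<Longrightarrow> depth x \<noteq> 0 \<Longrightarrow> parent x \<in> N \<and> depth x = Suc (depth (parent x))"
begin

definition tree :: "'t graph" where
  "tree = \<lparr>verts = N, edges = {{x, parent x} | x. x \<in> N \<and> depth x \<noteq> 0}\<rparr>"

lemma verts_tree [simp]: "verts tree = N"
  by (simp add: tree_def)

lemma adj_tree:
  "adj tree x y \<longleftrightarrow>
    x \<in> N \<and> depth x \<noteq> 0 \<and> y = parent x \<or> y \<in> N \<and> depth y \<noteq> 0 \<and> x = parent y"
  by (auto simp: adj_def tree_def doubleton_eq_iff)

lemma adj_tree_parent: "x \<in> N \<Longrightarrow> depth x \<noteq> 0 \<Longrightarrow> adj tree x (parent x)"
  by (simp add: adj_tree)

lemma adj_tree_depth_le: "adj tree x y \<Longrightarrow> depth y \<le> depth x \<Longrightarrow> depth x \<noteq> 0 \<and> y = parent x"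
  using parent[of y] by (auto simp: adj_tree)

lemma simple_tree: "simple_graph tree"
proof -
  have "{x, parent x} \<subseteq> N \<and> card {x, parent x} = 2" if "x \<in> N" "depth x \<noteq> 0" for x
  proof -
    have "x \<noteq> parent x" using parent[OF that] by (metis n_not_Suc_n)
    then show ?thesis using parent[OF that] that by simp
  qed
  then show ?thesis by (auto simp: simple_graph_def tree_def)
qed

text \<open>Climbing through parents stays in \<open>A\<close> and, as the depth decreases, ends at
  \<open>a\<close>. This serves for the whole tree and for the set of nodes whose parts contain a
  given vertex.\<close>

lemma linked_in_up_closed:
  assumes A: "A \<subseteq> N" "a \<in> A" "t \<in> A"
    and up: "\<And>t. t \<in> A \<Longrightarrow> t \<noteq> a \<Longrightarrow> depth t \<noteq> 0 \<and> parent t \<in> A"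
  shows "linked (induced tree A) t a"
  using A(3)
proof (induction "depth t" arbitrary: t rule: less_induct)
  case less
  show ?case
  proof (cases "t = a")
    case True
    have "a \<in> verts (induced tree A)" using A(1,2) by auto
    then show ?thesis unfolding True by (rule linked_refl)
  next
    case False
    have tA: "t \<in> A" by (rule less.prems)
    have u: "depth t \<noteq> 0" "parent t \<in> A" using up[OF tA False] by simp_all
    have t: "t \<in> N" using A(1) tA by blast
    have d: "depth (parent t) < depth t" "parent t \<in> N" using parent[OF t u(1)] by simp_all
    have "linked (induced tree A) t (parent t)"
    proof (rule linked_step[OF linked_refl])
      show "adj (induced tree A) t (parent t)"
        using adj_tree_parent[OF t u(1)] tA u(2) by simp
    qed (use t d tA u(2) in simp_all)
    from linked_trans[OF this less.hyps[OF d(1) u(2)]] show ?thesis .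
  qed
qed

lemma connected_tree: "connected_graph tree"
proof -
  have to_root: "linked tree t root" if "t \<in> N" for t
  proof (rule linked_mono)
    show "linked (induced tree N) t root"
    proof (rule linked_in_up_closed)
      fix x assume "x \<in> N" "x \<noteq> root"
      then show "depth x \<noteq> 0 \<and> parent x \<in> N" using root_unique[of x] parent[of x] by blast
    qed (use root that in simp_all)
  qed (use that in simp_all)
  have "linked tree s t" if "s \<in> N" "t \<in> N" for s t
    using linked_trans[OF to_root linked_sym[OF to_root]] that by blast
  then show ?thesis using root by (auto simp: connected_graph_def)
qed

text \<open>Both neighbours of a deepest vertex of a cycle would be its parent.\<close>

lemma acyclic_tree: "\<not> is_cycle tree p"
proof
  assume "is_cycle tree p"
  then have p: "is_path tree p" "length p \<ge> 3" "adj tree (last p) (hd p)"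
    by (auto simp: is_cycle_def)
  define n where "n = length p"
  have n: "n \<ge> 3" and ne: "p \<noteq> []" using p by (auto simp: n_def)
  define c where "c j = p ! (j mod n)" for j
  have adj_c: "adj tree (c j) (c (Suc j))" for j
  proof (cases "Suc (j mod n) = n")
    case True
    then have "j mod n = n - 1" "Suc j mod n = 0" by (simp_all add: mod_Suc)
    then have "c j = last p" "c (Suc j) = hd p"
      using ne by (simp_all add: c_def hd_conv_nth last_conv_nth n_def)
    then show ?thesis using p(3) by simp
  next
    case False
    have "j mod n < n" using n by simp
    then have "Suc (j mod n) < length p" using False by (simp add: n_def)
    then show ?thesis
      using p(1) False by (simp add: c_def mod_Suc is_path_def successively_conv_nth)
  qed
  have "finite (depth ` set p)" "depth ` set p \<noteq> {}" using ne by auto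
  then have "Max (depth ` set p) \<in> depth ` set p" by (rule Max_in)
  then obtain x where x0: "x \<in> set p" "Max (depth ` set p) = depth x" by blast
  have x: "depth y \<le> depth x" if "y \<in> set p" for y
    unfolding x0(2)[symmetric] using that by (intro Max_ge) auto
  from x0(1) obtain i where i: "i < n" "p ! i = x" by (auto simp: in_set_conv_nth n_def)
  \<comment> \<open>The cyclic predecessor of position \<open>i\<close>; the summand
    \<open>n\<close> prevents truncation at \<open>i = 0\<close>. Since both neighbours of
    \<open>x\<close> are its parent, \<open>n\<close> will divide 2.\<close>
  define j where "j = i + n - 1"
  have Suc_j: "Suc j = i + n" using n by (simp add: j_def)
  then have c_x: "c (Suc j) = x" using i by (simp add: c_def)
  have c_in: "c k \<in> set p" for k
    unfolding c_def by (rule nth_mem) (use ne in \<open>simp add: n_def\<close>)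
  have "adj tree x (c j)" "adj tree x (c (Suc (Suc j)))"
    using adj_c[of j] adj_c[of "Suc j"] adj_commute[of tree x "c j"] by (simp_all only: c_x)
  then have "c j = parent x" "c (Suc (Suc j)) = parent x"
    using adj_tree_depth_le x[OF c_in] by blast+
  then have "p ! (j mod n) = p ! (Suc (Suc j) mod n)" by (simp only: c_def)
  moreover have "j mod n < length p" "Suc (Suc j) mod n < length p" using ne by (simp_all add: n_def)
  ultimately have "j mod n = Suc (Suc j) mod n"
    using p(1) nth_eq_iff_index_eq by (metis is_path_def)
  then have "n dvd Suc (Suc j) - j" using mod_eq_dvd_iff_nat[of j "Suc (Suc j)" n] by simp
  then have "n dvd 2" by (simp add: numeral_2_eq_2)
  then show False using n dvd_imp_le[of n 2] by simp
qed

lemma is_tree_tree: "is_tree tree"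
  using simple_tree connected_tree acyclic_tree by (simp add: is_tree_def)

text \<open>From a vertex of least depth a ray must descend, and it never turns up again, because it
  has just come from the only parent. So some tail is a chain of successive children.\<close>

lemma rayless_tree:
  assumes no_chain: "\<And>s. (\<And>k. s k \<in> N) \<Longrightarrow> (\<And>k. depth (s (Suc k)) \<noteq> 0) \<Longrightarrow>
      (\<And>k. parent (s (Suc k)) = s k) \<Longrightarrow> False"
  shows "rayless tree"
  unfolding rayless_def
proof
  assume "\<exists>r. is_ray tree r"
  then obtain r where "is_ray tree r" by blast
  then have r: "inj r" "\<And>n. r n \<in> N" "\<And>n. adj tree (r n) (r (Suc n))"
    by (auto simp: is_ray_def)
  obtain m where m: "\<And>n. depth (r m) \<le> depth (r n)"
    using ex_has_least_nat[of "\<lambda>_. True" 0 "\<lambda>n. depth (r n)"] by auto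
  have down: "depth (r (Suc (m + k))) \<noteq> 0 \<and> parent (r (Suc (m + k))) = r (m + k)" for k
  proof (induction k)
    case 0
    have "\<not> (depth (r m) \<noteq> 0 \<and> r (Suc m) = parent (r m))"
      using parent[OF r(2)[of m]] m[of "Suc m"] by auto
    then show ?case using r(3)[of m] by (auto simp: adj_tree)
  next
    case (Suc k)
    have "r (Suc (Suc (m + k))) \<noteq> r (m + k)" using r(1) by (auto dest: injD)
    then have "r (Suc (Suc (m + k))) \<noteq> parent (r (Suc (m + k)))" using Suc by simp
    then show ?case using r(3)[of "Suc (m + k)"] by (auto simp: adj_tree)
  qed
  show False by (rule no_chain[of "\<lambda>k. r (m + k)"]) (use r(2) down in auto)
qed

text \<open>The condition on paths is replaced by a local one: except at \<open>apex v\<close>, a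
  part containing \<open>v\<close> shares it with the parent's part. The nodes concerned are then
  connected through the apex, and paths between them stay among them.\<close>

lemma tree_decomposition_tree:
  assumes cover: "(\<Union>t\<in>N. \<V> t) = verts G"
    and edge: "\<And>v w. {v, w} \<in> edges G \<Longrightarrow> \<exists>t\<in>N. v \<in> \<V> t \<and> w \<in> \<V> t"
    and G: "simple_graph G"
    and apex: "\<And>v. v \<in> verts G \<Longrightarrow> apex v \<in> N \<and> v \<in> \<V> (apex v)"
    and up: "\<And>v t. t \<in> N \<Longrightarrow> v \<in> \<V> t \<Longrightarrow> t \<noteq> apex v \<Longrightarrow> depth t \<noteq> 0 \<and> v \<in> \<V> (parent t)"
  shows "tree_decomposition G tree \<V>"
  unfolding tree_decomposition_def verts_tree
proof (intro conjI allI impI ballI)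
  fix e assume e: "e \<in> edges G"
  then have "card e = 2" using G by (simp add: simple_graph_def)
  then obtain v w where vw: "e = {v, w}" by (meson card_2_iff)
  then obtain t where "t \<in> N" "v \<in> \<V> t" "w \<in> \<V> t" using edge[of v w] e by blast
  then show "\<exists>t\<in>N. e \<subseteq> \<V> t" unfolding vw by blast
next
  fix t\<^sub>1 t\<^sub>3 p t\<^sub>2 assume p: "path_between tree t\<^sub>1 p t\<^sub>3" and t2: "t\<^sub>2 \<in> set p"
  have t13: "t\<^sub>1 \<in> N" "t\<^sub>3 \<in> N"
    using p by (auto simp: path_between_def is_path_def subset_iff)
  show "\<V> t\<^sub>1 \<inter> \<V> t\<^sub>3 \<subseteq> \<V> t\<^sub>2"
  proof
    fix v assume v: "v \<in> \<V> t\<^sub>1 \<inter> \<V> t\<^sub>3"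
    then have "v \<in> verts G" using cover t13 by blast
    note apexv = apex[OF this]
    let ?A = "{t \<in> N. v \<in> \<V> t}"
    have "depth t \<noteq> 0 \<and> parent t \<in> ?A" if "t \<in> ?A" "t \<noteq> apex v" for t
    proof -
      have "t \<in> N" "v \<in> \<V> t" using that(1) by auto
      then show ?thesis using up[OF _ _ that(2)] parent[of t] by blast
    qed
    then have to_apex: "linked (induced tree ?A) t (apex v)" if "t \<in> ?A" for t
      using apexv that by (intro linked_in_up_closed) blast+
    have "set p \<subseteq> ?A"
    proof (rule connected_subset_path_closed[OF is_tree_tree _ _ p])
      fix s t assume "s \<in> ?A" "t \<in> ?A"
      then show "linked (induced tree ?A) s t"
        using linked_trans[OF to_apex linked_sym[OF to_apex]] by blast
    qed (use v t13 in simp_all)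
    then show "v \<in> \<V> t\<^sub>2" using t2 by blast
  qed
qed (use is_tree_tree cover in auto)

end


section \<open>The decomposition of a graph without a comb\<close>

locale comb_free =
  fixes G :: "'a graph" and U :: "'a set"
  assumes simple_G: "simple_graph G" and connected_G: "connected_graph G"
    and U_verts: "U \<subseteq> verts G" and U_nonempty: "U \<noteq> {}"
    and no_comb: "\<not> has_comb_attached_to G U"
begin

text \<open>\<open>Q\<close> is the path deleted last, empty only at the start, when there is
  nothing to link to. The demand on the last vertex is conditional so that a path exists also in a
  component avoiding \<open>U\<close>, where it merely names the node.\<close>

definition admissible_path :: "'a set \<Rightarrow> 'a set \<Rightarrow> 'a list \<Rightarrow> bool" where
  "admissible_path Q C p \<longleftrightarrow> is_path G p \<and> set p \<subseteq> C \<and> (C \<inter> U \<noteq> {} \<longrightarrow> last p \<in> U) \<and>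
     (Q \<noteq> {} \<longrightarrow> (\<exists>y\<in>Q. adj G y (hd p)))"

text \<open>Starting from all of \<open>G\<close>, repeatedly delete a path that leads from the previously deleted
  path to \<open>U\<close>, and pass to the component containing \<open>v\<close>.  The state \<open>st n v\<close> consists of the set
  \<open>S n v\<close> of vertices deleted so far and the vertex set of the last deleted path; \<open>C n v\<close> is the
  current component and \<open>p n v\<close> the path deleted next.  These are meaningful as long as \<open>v\<close> has not
  been deleted.\<close>

primrec st :: "nat \<Rightarrow> 'a \<Rightarrow> 'a set \<times> 'a set" where
  "st 0 v = ({}, {})"
| "st (Suc n) v =
    (let p = SOME p. admissible_path (snd (st n v)) (component_of (delete_verts G (fst (st n v))) v) p
     in (fst (st n v) \<union> set p, set p))"

definition S :: "nat \<Rightarrow> 'a \<Rightarrow> 'a set" where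
  "S n v = fst (st n v)"

definition C :: "nat \<Rightarrow> 'a \<Rightarrow> 'a set" where
  "C n v = component_of (delete_verts G (S n v)) v"

definition p :: "nat \<Rightarrow> 'a \<Rightarrow> 'a list" where
  "p n v = (SOME p. admissible_path (snd (st n v)) (C n v) p)"

lemma st_Suc: "st (Suc n) v = (S n v \<union> set (p n v), set (p n v))"
  by (simp add: Let_def S_def C_def p_def)

lemma S_0 [simp]: "S 0 v = {}"
  by (simp add: S_def)

lemma S_Suc: "S (Suc n) v = S n v \<union> set (p n v)"
  by (simp add: S_def[of "Suc n"] st_Suc del: st.simps)

lemma S_iff: "x \<in> S n v \<longleftrightarrow> (\<exists>m<n. x \<in> set (p m v))"
  by (induction n) (auto simp: S_Suc less_Suc_eq)

lemma finite_S: "finite (S n v)"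
  by (induction n) (simp_all add: S_Suc)

lemma C_iff: "w \<in> C n v \<longleftrightarrow> linked (delete_verts G (S n v)) v w"
  by (simp add: C_def component_of_def)

lemma C_D: "w \<in> C n v \<Longrightarrow> w \<in> verts G \<and> w \<notin> S n v"
  using linked_verts[of "delete_verts G (S n v)" v w] by (simp add: C_iff)

lemma C_subset_verts: "C n v \<subseteq> verts G"
  using C_D by blast

lemma C_self: "v \<in> verts G \<Longrightarrow> v \<notin> S n v \<Longrightarrow> v \<in> C n v"
  unfolding C_iff by (rule linked_refl) simp

lemma C_0: "v \<in> verts G \<Longrightarrow> C 0 v = verts G"
proof
  assume v: "v \<in> verts G"
  show "verts G \<subseteq> C 0 v"
  proof
    fix w assume "w \<in> verts G"
    then have "linked G v w" using connected_G v by (simp add: connected_graph_def)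
    then have "linked (delete_verts G {}) v w"
      by (rule linked_mono) (use v linked_verts[of G v] in auto)
    then show "w \<in> C 0 v" by (simp add: C_iff)
  qed
qed (rule C_subset_verts)

lemma C_Suc_subset: "C (Suc n) v \<subseteq> C n v"
proof
  fix w assume "w \<in> C (Suc n) v"
  then have w: "linked (delete_verts G (S (Suc n) v)) v w" by (simp add: C_iff)
  have "linked (delete_verts G (S n v)) v w"
    by (rule linked_mono[OF w]) (use linked_verts[OF w] in \<open>simp_all add: S_Suc\<close>)
  then show "w \<in> C n v" by (simp add: C_iff)
qed

lemma C_antimono: "m \<le> n \<Longrightarrow> C n v \<subseteq> C m v"
  by (rule lift_Suc_antimono_le[of "\<lambda>n. C n v"]) (rule C_Suc_subset)

lemma C_cong: "st n w = st n v \<Longrightarrow> w \<in> C n v \<Longrightarrow> C n w = C n v"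
  using component_of_eq[of "delete_verts G (S n v)" v w] by (simp add: C_iff) (simp add: C_def S_def)

text \<open>The choice of \<open>p n v\<close> depends on \<open>v\<close> only through the state
  and the component. Vertices together at some time were together at all earlier times, so their
  histories coincide.\<close>

lemma st_agree: "w \<in> C n v \<Longrightarrow> st n w = st n v"
proof (induction n)
  case (Suc n)
  then have w: "w \<in> C n v" using C_Suc_subset by blast
  have "S n w = S n v" "C n w = C n v" "snd (st n w) = snd (st n v)"
    using Suc.IH[OF w] C_cong[OF _ w] by (simp_all add: S_def)
  then show ?case unfolding st_Suc p_def by simp
qed simp

lemma agree:
  assumes "w \<in> C n v" "m \<le> n"
  shows "S m w = S m v" "C m w = C m v" "p m w = p m v"
proof -
  have w: "w \<in> C m v" using C_antimono assms by blast
  show "S m w = S m v" "C m w = C m v" "p m w = p m v"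
    using st_agree[OF w] C_cong[OF _ w] by (simp_all add: S_def p_def)
qed

lemma p_subset_S: "m < n \<Longrightarrow> set (p m v) \<subseteq> S n v"
  by (auto simp: S_iff)

lemma not_in_S_antimono: "v \<notin> S n v \<Longrightarrow> m \<le> n \<Longrightarrow> v \<notin> S m v"
  by (auto simp: S_iff)

text \<open>If no vertex of \<open>C n v\<close> had a neighbour on the path just deleted, then
  \<open>C n v\<close> would be closed under the edges available one step earlier and would contain
  the deleted vertex \<open>hd (p m v)\<close>. From a vertex next to that path, connectedness of
  \<open>C n v\<close> leads to \<open>U\<close> if \<open>C n v\<close> meets it.\<close>

lemma admissible_path_exists:
  assumes v: "v \<in> verts G" "v \<notin> S n v"
    and prev: "\<And>m. n = Suc m \<Longrightarrow> admissible_path (snd (st m v)) (C m v) (p m v)"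
  shows "\<exists>p. admissible_path (snd (st n v)) (C n v) p"
proof -
  let ?H = "delete_verts G (S n v)"
  have "\<exists>x\<in>C n v. n \<noteq> 0 \<longrightarrow> (\<exists>y\<in>snd (st n v). adj G y x)"
  proof (cases n)
    case 0
    then show ?thesis using C_self[OF v] by blast
  next
    case (Suc m)
    have pm: "is_path G (p m v)" "set (p m v) \<subseteq> C m v"
      using prev[OF Suc] by (simp_all add: admissible_path_def)
    show ?thesis
    proof (rule ccontr)
      assume "\<not> ?thesis"
      then have no: "\<not> adj G y x" if "x \<in> C n v" "y \<in> set (p m v)" for x y
        using that by (auto simp: Suc st_Suc simp del: st.simps)
      have "hd (p m v) \<in> set (p m v)" using pm(1) by (simp add: is_path_def)
      then have hd: "hd (p m v) \<in> C m v" "hd (p m v) \<in> S n v"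
        using pm(2) by (auto simp: Suc S_Suc)
      then have "linked (delete_verts G (S m v)) v (hd (p m v))" by (simp add: C_iff)
      then have "hd (p m v) \<in> C n v"
      proof (rule linked_closed[OF _ C_self[OF v]])
        fix a b assume ab: "a \<in> C n v" "b \<in> verts (delete_verts G (S m v))"
          "adj (delete_verts G (S m v)) a b"
        then have "b \<notin> set (p m v)" using no[of a b] by (auto simp: adj_commute)
        then have "b \<in> verts ?H" "adj ?H a b"
          using ab C_D[OF ab(1)] by (simp_all add: Suc S_Suc)
        then show "b \<in> C n v" using ab(1) linked_step[of ?H v a b] by (simp add: C_iff)
      qed
      then show False using hd(2) C_D by blast
    qed
  qed
  then obtain x where x: "x \<in> C n v" "n \<noteq> 0 \<Longrightarrow> \<exists>y\<in>snd (st n v). adj G y x" by blast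
  obtain u where u: "u \<in> C n v" "C n v \<inter> U \<noteq> {} \<longrightarrow> u \<in> U" using x(1) by blast
  have "linked ?H x u"
    using x(1) u(1) linked_trans[OF linked_sym] by (simp add: C_iff)
  then obtain q where q: "is_path ?H q" "hd q = x" "last q = u"
    by (auto simp: linked_def path_between_def)
  have "is_path G q" by (rule path_subgraph[OF q(1)]) (use q(1) in \<open>auto simp: is_path_def\<close>)
  moreover have "set q \<subseteq> C n v"
  proof
    fix z assume "z \<in> set q"
    then have "linked ?H x z" using path_linked_hd[OF q(1)] q(2) by simp
    then show "z \<in> C n v" using x(1) linked_trans[of ?H v x z] by (simp add: C_iff)
  qed
  moreover have "snd (st n v) \<noteq> {} \<longrightarrow> (\<exists>y\<in>snd (st n v). adj G y (hd q))"
    using x(2) q(2) by (cases "n = 0") auto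
  ultimately have "admissible_path (snd (st n v)) (C n v) q"
    using q(3) u(2) by (simp add: admissible_path_def)
  then show ?thesis by blast
qed

lemma admissible_p:
  assumes v: "v \<in> verts G" "v \<notin> S n v"
  shows "admissible_path (snd (st n v)) (C n v) (p n v)"
  using v(2)
proof (induction n)
  case 0
  show ?case unfolding p_def by (rule someI_ex[OF admissible_path_exists[OF v(1)]]) simp_all
next
  case (Suc n)
  have "v \<notin> S n v" using Suc.prems not_in_S_antimono[of v "Suc n" n] by simp
  from Suc.IH[OF this] have IH: "admissible_path (snd (st n v)) (C n v) (p n v)" .
  show ?case unfolding p_def[of "Suc n"]
    by (rule someI_ex[OF admissible_path_exists[OF v(1) Suc.prems]]) (use IH in simp)
qed

lemma p_props:
  assumes v: "v \<in> verts G" "v \<notin> S n v"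
  shows "is_path G (p n v)" "set (p n v) \<subseteq> C n v" "C n v \<inter> U \<noteq> {} \<Longrightarrow> last (p n v) \<in> U"
    and "hd (p n v) \<in> set (p n v)"
  using admissible_p[OF v] by (auto simp: admissible_path_def is_path_def)

lemma p_link:
  assumes v: "v \<in> verts G" "v \<notin> S (Suc n) v"
  shows "\<exists>y\<in>set (p n v). adj G y (hd (p (Suc n) v))"
proof -
  have "v \<notin> S n v" using v(2) not_in_S_antimono[of v "Suc n" n] by simp
  from p_props(4)[OF v(1) this] have "set (p n v) \<noteq> {}" by auto
  moreover have "snd (st (Suc n) v) = set (p n v)" by (simp only: st_Suc snd_conv)
  ultimately show ?thesis using admissible_p[OF v] unfolding admissible_path_def by metis
qed

text \<open>By the first hypothesis \<open>w k\<close> shares the history of each earlier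
  \<open>w j\<close> up to time \<open>e + j\<close>, so the paths are consecutive deletions of one
  process. A constant \<open>w\<close> shows that a vertex stops; a varying one handles a branch of
  the tree that starts at depth \<open>e\<close>.\<close>

lemma no_infinite_chain:
  assumes w: "\<And>j k. j \<le> k \<Longrightarrow> w j \<in> C (e + j) (w k)"
    and meets: "\<And>k. C (e + k) (w k) \<inter> U \<noteq> {}"
  shows False
proof -
  define q where "q k = p (e + k) (w k)" for k
  have wk: "w k \<in> verts G" "w k \<notin> S (e + k) (w k)" for k
    using C_D[OF w[of k k]] by simp_all
  have q_eq: "q j = p (e + j) (w k)" if "j \<le> k" for j k
    using agree(3)[OF w[OF that], of "e + j"] by (simp add: q_def)
  have "has_comb_attached_to G U"
  proof (rule comb_of_linked_paths[of G q])
    fix n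
    show "is_path G (q n)" "last (q n) \<in> U"
      using p_props(1,3)[OF wk[of n]] meets[of n] by (simp_all add: q_def)
    show "\<exists>y\<in>set (q n). adj G y (hd (q (Suc n)))"
      using p_link[of "w (Suc n)" "e + n"] wk[of "Suc n"] q_eq[of n "Suc n"] by (simp add: q_def)
  next
    fix m n :: nat assume mn: "m < n"
    then have "set (q m) \<subseteq> S (e + n) (w n)" using p_subset_S q_eq[of m n] by simp
    moreover have "set (q n) \<subseteq> C (e + n) (w n)" using p_props(2)[OF wk] by (simp add: q_def)
    ultimately show "set (q m) \<inter> set (q n) = {}" using C_D by blast
  qed
  then show False using no_comb by blast
qed

section \<open>The time at which a vertex is assigned to a part\<close>

definition stops :: "nat \<Rightarrow> 'a \<Rightarrow> bool" where
  "stops n v \<longleftrightarrow> v \<in> set (p n v) \<or> C n v \<inter> U = {}"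

definition ell :: "'a \<Rightarrow> nat" where
  "ell v = (LEAST n. stops n v)"

lemma ex_stops: assumes v: "v \<in> verts G" shows "\<exists>n. stops n v"
proof (rule ccontr)
  assume "\<nexists>n. stops n v"
  then have not_p: "v \<notin> set (p n v)" and meets: "C n v \<inter> U \<noteq> {}" for n
    by (auto simp: stops_def)
  have "v \<in> C n v" for n using C_self[OF v] not_p by (simp add: S_iff)
  then show False using no_infinite_chain[of "\<lambda>_. v" 0] meets by simp
qed

lemma stops_ell: "v \<in> verts G \<Longrightarrow> stops (ell v) v"
  unfolding ell_def by (rule LeastI_ex) (rule ex_stops)

lemma not_stops: "n < ell v \<Longrightarrow> \<not> stops n v"
  unfolding ell_def by (rule not_less_Least)

lemma ell_not_in_S: "v \<notin> S (ell v) v"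
  using not_stops by (auto simp: S_iff stops_def)

lemma before_ell:
  assumes v: "v \<in> verts G" and n: "n \<le> ell v" shows "v \<notin> S n v" "v \<in> C n v"
proof -
  show "v \<notin> S n v" using ell_not_in_S n not_in_S_antimono by blast
  then show "v \<in> C n v" using C_self[OF v] by blast
qed

text \<open>Before time \<open>n\<close> both vertices share component and path. The component meets
  \<open>U\<close> since \<open>v\<close> has not stopped, and \<open>w\<close> is not on the path
  since it still lies in \<open>C n v\<close>; so \<open>w\<close> has not stopped earlier
  either.\<close>

lemma ell_eqI:
  assumes n: "n \<le> ell v" and w: "w \<in> C n v" and stop: "stops n w"
  shows "ell w = n"
  unfolding ell_def
proof (rule Least_equality)
  show "stops n w" by (rule stop)
  fix m assume m: "stops m w"
  show "n \<le> m"
  proof (rule ccontr)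
    assume "\<not> n \<le> m"
    then have mn: "m < n" by simp
    have eq: "C m w = C m v" "p m w = p m v" using agree[OF w] mn by simp_all
    have "w \<notin> set (p m v)" using p_subset_S[OF mn] C_D[OF w] by blast
    moreover have "C m v \<inter> U \<noteq> {}" using not_stops[of m v] mn n by (simp add: stops_def)
    ultimately show False using m by (simp add: stops_def eq)
  qed
qed

text \<open>The node for the state \<open>st n v\<close> is represented by the first vertex of \<open>p n v\<close>.\<close>

definition node :: "nat \<Rightarrow> 'a \<Rightarrow> 'a" where
  "node n v = hd (p n v)"

definition apex :: "'a \<Rightarrow> 'a" where
  "apex v = node (ell v) v"

definition nodes :: "'a set" where
  "nodes = {x \<in> verts G. apex x = x}"

text \<open>For a node with \<open>ell x = 0\<close> the subtraction truncates and \<open>x\<close>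
  is its own parent; the tree has no edge for this value.\<close>

definition parent :: "'a \<Rightarrow> 'a" where
  "parent x = node (ell x - 1) x"

definition part :: "'a \<Rightarrow> 'a set" where
  "part x = S (ell x) x \<union> (if C (ell x) x \<inter> U = {} then C (ell x) x else set (p (ell x) x))"

text \<open>The first vertex of \<open>p n v\<close> lies in \<open>C n v\<close>, hence has the
  history of \<open>v\<close> up to time \<open>n\<close>, and stops then because it lies on the
  path. So it is its own apex.\<close>

lemma node_props:
  assumes v: "v \<in> verts G" and n: "n \<le> ell v"
  shows "node n v \<in> C n v" "node n v \<in> nodes" "ell (node n v) = n"
proof -
  let ?x = "node n v"
  note vn = before_ell[OF v n]
  have xp: "?x \<in> set (p n v)" unfolding node_def by (rule p_props(4)[OF v vn(1)])
  then show x: "?x \<in> C n v" using p_props(2)[OF v vn(1)] by blast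
  have eq: "p n ?x = p n v" by (rule agree(3)[OF x order_refl])
  show ell: "ell ?x = n"
    by (rule ell_eqI[OF n x]) (use xp in \<open>simp add: stops_def eq\<close>)
  have "node n ?x = ?x" unfolding node_def[of n "node n v"] eq by (simp add: node_def)
  then show "?x \<in> nodes" using C_D[OF x] by (simp add: nodes_def apex_def ell)
qed

lemma part_node:
  assumes v: "v \<in> verts G" and n: "n \<le> ell v"
  shows "part (node n v) = S n v \<union> (if C n v \<inter> U = {} then C n v else set (p n v))"
  using agree[OF node_props(1)[OF assms] order_refl] by (simp add: part_def node_props(3)[OF assms])

lemma p_subset_part:
  assumes v: "v \<in> verts G" and n: "n \<le> ell v"
  shows "S n v \<subseteq> part (node n v)" "set (p n v) \<subseteq> part (node n v)"
  using part_node[OF assms] p_props(2)[OF v before_ell(1)[OF assms]] by auto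

lemma part_apex: "v \<in> verts G \<Longrightarrow> v \<in> part (apex v)"
  using part_node[of v "ell v"] stops_ell[of v] before_ell(2)[of v "ell v"]
  by (auto simp: apex_def stops_def)

lemma apex_in_nodes: "v \<in> verts G \<Longrightarrow> apex v \<in> nodes"
  unfolding apex_def by (rule node_props(2)) simp_all

lemma nodes_verts: "x \<in> nodes \<Longrightarrow> x \<in> verts G"
  by (simp add: nodes_def)

lemma node_ell: "x \<in> nodes \<Longrightarrow> node (ell x) x = x"
  by (simp add: nodes_def apex_def)

lemma p_ell_subset: "x \<in> verts G \<Longrightarrow> set (p (ell x) x) \<subseteq> C (ell x) x"
  by (rule p_props(2)[OF _ ell_not_in_S])

lemma part_subset_verts: "x \<in> nodes \<Longrightarrow> part x \<subseteq> verts G"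
proof -
  assume x: "x \<in> nodes"
  have "S (ell x) x \<subseteq> verts G"
  proof
    fix z assume "z \<in> S (ell x) x"
    then obtain m where "m < ell x" "z \<in> set (p m x)" by (auto simp: S_iff)
    then have "z \<in> C m x"
      using p_props(2)[OF nodes_verts[OF x] before_ell(1)[OF nodes_verts[OF x]], of m] by auto
    then show "z \<in> verts G" using C_D by blast
  qed
  then show ?thesis
    using C_subset_verts[of "ell x" x] p_ell_subset[OF nodes_verts[OF x]]
    by (auto simp: part_def split: if_splits)
qed

text \<open>A vertex of \<open>part t\<close> outside \<open>S (ell t) t\<close> stops exactly at
  time \<open>ell t\<close> and has \<open>t\<close> as its apex. The others were deleted earlier,
  and the parent's part contains all that was deleted up to and including its own path.\<close>

lemma part_up:
  assumes t: "t \<in> nodes" and v: "v \<in> part t" and ne: "t \<noteq> apex v"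
  shows "ell t \<noteq> 0 \<and> v \<in> part (parent t)"
proof -
  note tv = nodes_verts[OF t]
  have "v \<in> S (ell t) t"
  proof (rule ccontr)
    assume "v \<notin> S (ell t) t"
    then have stop: "v \<in> C (ell t) t \<and> (C (ell t) t \<inter> U = {} \<or> v \<in> set (p (ell t) t))"
      using v p_ell_subset[OF tv] by (auto simp: part_def split: if_splits)
    then have vC: "v \<in> C (ell t) t" by simp
    note eq = agree[OF vC order_refl]
    have "ell v = ell t"
      by (rule ell_eqI[OF order_refl vC]) (use stop in \<open>auto simp: stops_def eq\<close>)
    then have "apex v = t" using node_ell[OF t] by (simp add: apex_def node_def eq)
    then show False using ne by simp
  qed
  moreover from this obtain m where m: "ell t = Suc m" by (cases "ell t") simp_all
  ultimately have "v \<in> S m t \<or> v \<in> set (p m t)" by (simp add: S_Suc)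
  then have "v \<in> part (node m t)" using p_subset_part[OF tv, of m] m by auto
  then show ?thesis by (simp add: parent_def m)
qed

text \<open>Up to time \<open>ell v\<close> neither end is deleted, so the edge keeps
  \<open>w\<close> in the component of \<open>v\<close>. Then either this component avoids
  \<open>U\<close> and lies in \<open>part (apex v)\<close>, or \<open>v\<close> is on a path that
  also belongs to the history of \<open>w\<close> and hence lies in
  \<open>part (apex w)\<close>.\<close>

lemma edge_in_part:
  assumes vw: "adj G v w" and le: "ell v \<le> ell w"
  shows "\<exists>t\<in>nodes. v \<in> part t \<and> w \<in> part t"
proof -
  note verts = simple_graph_adjD(1,2)[OF simple_G vw]
  have w_in: "w \<in> C n v" if "n \<le> ell v" for n
    using that
  proof (induction n)
    case 0
    then show ?case using C_0 verts by simp
  next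
    case (Suc n)
    then have w: "w \<in> C n v" by simp
    have "S (Suc n) w = S (Suc n) v" using agree[OF w order_refl] by (simp add: S_Suc)
    moreover have "w \<notin> S (Suc n) w" "v \<notin> S (Suc n) v"
      using before_ell(1)[OF verts(1) Suc.prems] before_ell(1)[OF verts(2), of "Suc n"] Suc.prems le
      by simp_all
    ultimately have "linked (delete_verts G (S (Suc n) v)) v w"
      by (intro linked_step[OF linked_refl]) (use vw verts in simp_all)
    then show ?case by (simp add: C_iff)
  qed
  have w: "w \<in> C (ell v) v" by (rule w_in) simp
  note eq = agree[OF w order_refl]
  show ?thesis
  proof (cases "C (ell v) v \<inter> U = {}")
    case True
    then have "w \<in> part (apex v)" using w part_node[OF verts(1) order_refl] by (simp add: apex_def)
    then show ?thesis using part_apex apex_in_nodes verts(1) by blast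
  next
    case False
    then have vp: "v \<in> set (p (ell v) w)" using stops_ell[OF verts(1)] by (simp add: stops_def eq)
    have "v \<in> part (apex w)"
    proof (cases "ell v = ell w")
      case True
      with vp have "v \<in> set (p (ell w) w)" by simp
      then show ?thesis using p_subset_part(2)[OF verts(2) order_refl] unfolding apex_def by blast
    next
      case neq: False
      then have "v \<in> S (ell w) w" using vp le p_subset_S[of "ell v" "ell w" w] by (simp add: subset_iff)
      then show ?thesis using p_subset_part(1)[OF verts(2) order_refl] unfolding apex_def by blast
    qed
    then show ?thesis using part_apex apex_in_nodes verts(2) by blast
  qed
qed

text \<open>Each path is joined to the preceding one by an edge. The index is a successor because
  \<open>S 0 v\<close> is empty and connected graphs are nonempty.\<close>

lemma S_connected:
  assumes v: "v \<in> verts G" shows "v \<notin> S (Suc n) v \<Longrightarrow> connected_graph (induced G (S (Suc n) v))"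
proof (induction n)
  have path: "linked (induced G A) a b"
    if n: "v \<notin> S n v" and A: "set (p n v) \<subseteq> A" and ab: "a \<in> set (p n v)" "b \<in> set (p n v)" for n A a b
  proof -
    have pn: "is_path G (p n v)" by (rule p_props(1)[OF v n])
    have "is_path (induced G A) (p n v)"
      by (rule path_subgraph[OF pn]) (use pn A in \<open>auto simp: is_path_def\<close>)
    then show ?thesis using path_linked_hd linked_trans[OF linked_sym] ab by metis
  qed
  {
    case 0
    have n: "v \<notin> S 0 v" by simp
    have "set (p 0 v) \<subseteq> verts G" using p_props(1)[OF v n] by (simp add: is_path_def)
    then show ?case
      using path[OF n order_refl] p_props(4)[OF v n] by (auto simp: connected_graph_def S_Suc)
  next
    case (Suc n)
    let ?A = "S (Suc n) v" and ?B = "S (Suc (Suc n)) v"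
    have nSn: "v \<notin> S (Suc n) v" using Suc.prems not_in_S_antimono[of v "Suc (Suc n)" "Suc n"] by simp
    have B: "?B = ?A \<union> set (p (Suc n) v)" by (rule S_Suc)
    have con: "connected_graph (induced G ?A)" by (rule Suc.IH[OF nSn])
    have pS: "set (p (Suc n) v) \<subseteq> verts G" using p_props(1)[OF v nSn] by (simp add: is_path_def)
    obtain y where y: "y \<in> set (p n v)" "adj G y (hd (p (Suc n) v))" using p_link[OF v nSn] by blast
    let ?x = "hd (p (Suc n) v)"
    have x: "?x \<in> set (p (Suc n) v)" by (rule p_props(4)[OF v nSn])
    have yA: "y \<in> ?A" "y \<in> verts G"
      using y simple_graph_adjD(1)[OF simple_G] by (auto simp: S_Suc)
    have yx: "linked (induced G ?B) y ?x"
      by (rule linked_step[OF linked_refl]) (use y(2) x yA pS B in auto)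
    have to_y: "linked (induced G ?B) y a" if "a \<in> verts (induced G ?B)" for a
    proof (cases "a \<in> ?A")
      case True
      then have "linked (induced G ?A) y a"
        using con yA that by (simp add: connected_graph_def)
      then show ?thesis by (rule linked_mono) (use yA B simple_graph_adjD(2)[OF simple_G] in auto)
    next
      case False
      then have "a \<in> set (p (Suc n) v)" using that B by auto
      then have "linked (induced G ?B) ?x a" using path[OF nSn _ x] B by blast
      then show ?thesis by (rule linked_trans[OF yx])
    qed
    have "linked (induced G ?B) a b" if "a \<in> verts (induced G ?B)" "b \<in> verts (induced G ?B)" for a b
      using linked_trans[OF linked_sym[OF to_y[OF that(1)]] to_y[OF that(2)]] .
    moreover have "verts (induced G ?B) \<noteq> {}" using yA B by auto
    ultimately show ?case unfolding connected_graph_def by blast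
  }
qed

lemma parent_props:
  assumes x: "x \<in> nodes" and d: "ell x \<noteq> 0"
  shows "parent x \<in> nodes" "ell x = Suc (ell (parent x))"
  using node_props[OF nodes_verts[OF x], of "ell x - 1"] d by (simp_all add: parent_def)

text \<open>Since \<open>x\<close> has not stopped at time \<open>n\<close>, the component at its
  parent meets \<open>U\<close>. So the parent's part consists of deleted paths only, and
  \<open>part x\<close> contains all of them.\<close>

lemma part_inter_parent:
  assumes x: "x \<in> nodes" and d: "ell x = Suc n"
  shows "part x \<inter> part (parent x) = S (Suc n) x"
proof -
  note xv = nodes_verts[OF x]
  have "C n x \<inter> U \<noteq> {}" using not_stops[of n x] d by (simp add: stops_def)
  then have "part (parent x) = S (Suc n) x"
    using part_node[OF xv, of n] d by (simp add: parent_def S_Suc)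
  then show ?thesis by (auto simp: part_def d)
qed

section \<open>The tree of components and its decomposition of the graph\<close>

definition root :: 'a where
  "root = node 0 (SOME v. v \<in> verts G)"

sublocale parent_tree nodes parent ell root
proof
  have "\<exists>v. v \<in> verts G" using connected_G by (auto simp: connected_graph_def)
  then have v: "(SOME v. v \<in> verts G) \<in> verts G" by (rule someI_ex)
  show "root \<in> nodes" unfolding root_def using node_props(2)[OF v] by simp
  fix x assume x: "x \<in> nodes"
  then show "ell x \<noteq> 0 \<Longrightarrow> parent x \<in> nodes \<and> ell x = Suc (ell (parent x))"
    using parent_props by blast
  assume "ell x = 0"
  \<comment> \<open>At time 0 the only component is all of \<open>G\<close>, so all nodes with
    \<open>ell x = 0\<close> are the first vertex of the same path.\<close>
  moreover have "x \<in> C 0 (SOME v. v \<in> verts G)" using C_0[OF v] nodes_verts[OF x] by simp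
  ultimately show "x = root"
    using agree(3)[of x 0 _ 0] node_ell[OF x] by (simp add: root_def node_def)
qed

lemma rayless: "Defs.rayless tree"
proof (rule rayless_tree)
  fix s :: "nat \<Rightarrow> 'a"
  assume s: "\<And>k. s k \<in> nodes" "\<And>k. ell (s (Suc k)) \<noteq> 0" "\<And>k. parent (s (Suc k)) = s k"
  define e where "e = ell (s 0)"
  have ell_s: "ell (s k) = e + k" for k
  proof (induction k)
    case (Suc k)
    then show ?case using parent_props(2)[OF s(1) s(2), of k] s(3)[of k] by simp
  qed (simp add: e_def)
  have step: "s k \<in> C (e + k) (s (Suc k))" for k
    using node_props(1)[OF nodes_verts[OF s(1)], of "e + k" "Suc k"] s(3)[of k] ell_s[of "Suc k"]
    by (simp add: parent_def)
  have chain: "s j \<in> C (e + j) (s k)" if "j \<le> k" for j k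
    using that
  proof (induction k rule: dec_induct)
    case base
    show ?case using before_ell(2)[OF nodes_verts[OF s(1)], of "e + j" j] ell_s[of j] by simp
  next
    case (step k)
    have "C (e + j) (s k) = C (e + j) (s (Suc k))"
      using agree(2)[OF \<open>\<And>k. s k \<in> C (e + k) (s (Suc k))\<close>, of "e + j" k] step(1) by simp
    then show ?case using step(3) by simp
  qed
  \<comment> \<open>The child \<open>s (Suc k)\<close> has not stopped at time \<open>e + k\<close>,
    and it then shares the component of \<open>s k\<close>.\<close>
  have "C (e + k) (s k) \<inter> U \<noteq> {}" for k
    using not_stops[of "e + k" "s (Suc k)"] ell_s[of "Suc k"] agree(2)[OF step order_refl]
    by (simp add: stops_def)
  then show False using no_infinite_chain[OF chain] by blast
qed

lemma tree_decomposition_part: "tree_decomposition G tree part"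
proof (rule tree_decomposition_tree[OF _ _ simple_G, of part apex])
  show "(\<Union>t\<in>nodes. part t) = verts G"
    using part_subset_verts part_apex apex_in_nodes by blast
  fix v w assume "{v, w} \<in> edges G"
  then have "adj G v w" "adj G w v" by (simp_all add: adj_def insert_commute)
  then show "\<exists>t\<in>nodes. v \<in> part t \<and> w \<in> part t"
    using edge_in_part[of v w] edge_in_part[of w v] by (cases "ell v \<le> ell w") auto
next
  fix v assume "v \<in> verts G"
  then show "apex v \<in> nodes \<and> v \<in> part (apex v)" using part_apex apex_in_nodes by blast
next
  fix v t assume "t \<in> nodes" "v \<in> part t" "t \<noteq> apex v"
  then show "ell t \<noteq> 0 \<and> v \<in> part (parent t)" by (rule part_up)
qed

text \<open>A part can be infinite only if its component avoids \<open>U\<close>. A child of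
  \<open>t\<close> would have stopped in that component already, and \<open>t\<close> is not the
  root because \<open>U\<close> is nonempty; so the parent is its only neighbour.\<close>

lemma finite_part_nonleaf:
  assumes t: "t \<in> nodes" and nonleaf: "\<not> leaf tree t" shows "finite (part t)"
proof (cases "C (ell t) t \<inter> U = {}")
  case False
  then show ?thesis by (simp add: part_def finite_S)
next
  case True
  have "ell t \<noteq> 0"
    using True C_0[OF nodes_verts[OF t]] U_verts U_nonempty by (cases "ell t") auto
  moreover have no_child: False if s: "s \<in> nodes" "ell s \<noteq> 0" "t = parent s" for s
  proof -
    have n: "ell s = Suc (ell t)" using parent_props(2)[OF s(1,2)] s(3) by simp
    have "t = node (ell t) s" using s(3) n by (simp add: parent_def)
    then have "t \<in> C (ell t) s" using node_props(1)[OF nodes_verts[OF s(1)], of "ell t"] n by simp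
    then have "C (ell t) t = C (ell t) s" by (rule agree) simp
    then show False using True not_stops[of "ell t" s] n by (simp add: stops_def)
  qed
  ultimately have "{s. adj tree t s} = {parent t}" using t by (auto simp: adj_tree)
  then have "leaf tree t" using t by (simp add: leaf_def)
  then show ?thesis using nonleaf by simp
qed

lemma separator_eq:
  assumes "X \<in> separators tree part"
  shows "\<exists>x\<in>nodes. \<exists>n. ell x = Suc n \<and> X = S (Suc n) x"
proof -
  have *: "\<exists>n. ell x = Suc n \<and> part x \<inter> part (parent x) = S (Suc n) x" if "x \<in> nodes" "ell x \<noteq> 0" for x
    using part_inter_parent[OF that(1)] that(2) by (cases "ell x") auto
  obtain x y where X: "X = part x \<inter> part y" "adj tree x y" using assms by (auto simp: separators_def)
  then consider "x \<in> nodes" "ell x \<noteq> 0" "X = part x \<inter> part (parent x)"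
    | "y \<in> nodes" "ell y \<noteq> 0" "X = part y \<inter> part (parent y)"
    by (auto simp: adj_tree Int_commute)
  then show ?thesis using * by cases blast+
qed

lemma finite_separators_part: "finite_separators tree part"
  using separator_eq finite_S by (auto simp: finite_separators_def)

lemma connected_separators_part: "connected_separators G tree part"
  unfolding connected_separators_def
proof
  fix X assume "X \<in> separators tree part"
  then obtain x n where x: "x \<in> nodes" "ell x = Suc n" "X = S (Suc n) x" using separator_eq by blast
  then show "connected_graph (induced G X)"
    using S_connected[OF nodes_verts[OF x(1)], of n] ell_not_in_S[of x] by simp
qed

lemma rayless_decomposition_part: "rayless_decomposition_for G U tree part"
proof -
  have "finite (part t \<inter> U)" for t
    by (cases "C (ell t) t \<inter> U = {}") (simp_all add: part_def finite_S Int_Un_distrib2)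
  then show ?thesis
    using tree_decomposition_part rayless finite_part_nonleaf
    by (simp add: rayless_decomposition_for_def)
qed

end

lemma decomposition_exists:
  fixes G :: "'a graph"
  assumes "simple_graph G" "connected_graph G" "U \<subseteq> verts G" "\<not> has_comb_attached_to G U"
  shows "\<exists>(T :: 'a graph) \<V>. rayless_decomposition_for G U T \<V> \<and>
           finite_separators T \<V> \<and> connected_separators G T \<V>"
proof -
  obtain v where v: "v \<in> verts G" using assms(2) by (auto simp: connected_graph_def)
  \<comment> \<open>A decomposition for \<open>insert v U\<close> also serves \<open>U\<close>,
    whose traces on the parts are only smaller.\<close>
  interpret comb_free G "insert v U"
    using assms v comb_attached_to_insert[of G v U] by unfold_locales auto
  have "rayless_decomposition_for G U tree part"
    using rayless_decomposition_part unfolding rayless_decomposition_for_def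
    by (meson Int_mono finite_subset order_refl subset_insertI)
  then show ?thesis using finite_separators_part connected_separators_part by blast
qed

text \<open>The trees claimed to exist have vertices of \<open>G\<close> as nodes, while the middle
  conjunct ranges over trees of any type. It asks for finite separators before speaking of
  \<open>displays\<close> because (ii) does not enforce them: if \<open>T\<close> is a single edge,
  its two leaf parts may share infinitely many vertices.\<close>

theorem theorem2:
  fixes G :: "'a graph" and U :: "'a set"
  assumes "simple_graph G" and "connected_graph G" and "U \<subseteq> verts G"
  shows "(has_comb_attached_to G U \<noteq>
            (\<exists>(T :: 'a graph) \<V>. rayless_decomposition_for G U T \<V>)) \<and>
         (\<forall>(T :: 't graph) \<V>. rayless_decomposition_for G U T \<V> \<longrightarrow>
            \<not> has_comb_attached_to G U \<and>
            (finite_separators T \<V> \<longrightarrow> displays G T \<V> (boundary_ends G U))) \<and>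
         ((\<exists>(T :: 'a graph) \<V>. rayless_decomposition_for G U T \<V>) \<longrightarrow>
            (\<exists>(T :: 'a graph) \<V>. rayless_decomposition_for G U T \<V> \<and>
               finite_separators T \<V> \<and> connected_separators G T \<V> \<and>
               displays G T \<V> (boundary_ends G U)))"
proof -
  note no_comb = rayless_decomposition_no_comb[OF _ assms(3)]
  note displays = rayless_decomp.displays_boundary_ends[OF rayless_decomp_intro assms(3)]
  have ex: "\<exists>(T :: 'a graph) \<V>. rayless_decomposition_for G U T \<V> \<and>
      finite_separators T \<V> \<and> connected_separators G T \<V> \<and>
      displays G T \<V> (boundary_ends G U)" if nc: "\<not> has_comb_attached_to G U"
  proof -
    obtain T :: "'a graph" and \<V> where TV: "rayless_decomposition_for G U T \<V>"
      "finite_separators T \<V>" "connected_separators G T \<V>"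
      using decomposition_exists[OF assms nc] by blast
    with displays[OF TV(1,2)] show ?thesis by blast
  qed
  show ?thesis
  proof (intro conjI allI impI)
    show "has_comb_attached_to G U \<noteq>
        (\<exists>(T :: 'a graph) \<V>. rayless_decomposition_for G U T \<V>)"
      using no_comb ex by metis
  next
    assume "\<exists>(T :: 'a graph) \<V>. rayless_decomposition_for G U T \<V>"
    then have "\<not> has_comb_attached_to G U" using no_comb by metis
    then show "\<exists>(T :: 'a graph) \<V>. rayless_decomposition_for G U T \<V> \<and>
        finite_separators T \<V> \<and> connected_separators G T \<V> \<and>
        displays G T \<V> (boundary_ends G U)" by (rule ex)
  qed (rule no_comb displays; assumption)+
qed

end
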